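(* Let $(F^*,E^*,I^* )$ be a spark complex and let $k>0$. Then the following diagram, with the maps described in the context, commutes, and each of its rows and each of its columns is exact: $$ \begin{array}{ccccccccc} & & 0 & & 0 & & 0 & & \\ & & \downarrow & & \downarrow & & \downarrow & & \\ 0 & \to & \dfrac{H^k(F^* )}{H^k_I(F^* )} & \to & \widehat{\mathbf H}^k_E & \xrightarrow{\delta_1} & dE^k & \to & 0\\ & & \downarrow & & \downarrow & & \downarrow & & \\ 0 & \to & H^k(F^*/I^* ) & \to & \widehat{\mathbf H}^k & \xrightarrow{\delta_1} & Z^{k+1}_I(E^* ) & \to & 0\\ & & \downarrow{\scriptstyle\delta_2} & & \downarrow{\scriptstyle\delta_2} & & \downarrow & & \\ 0 & \to & H^{k+1}(F^*,I^* ) & \to & H^{k+1}(I^* ) & \to & H^{k+1}_I(F^* ) & \to & 0\\ & & \downarrow & & \downarrow & & \downarrow & & \\ & & 0 & & 0 & & 0 & & \end{array} $$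
   Context: A spark complex consists of a differential complex $(F^*,d)$ of abelian groups, graded in degrees $\ge 0$ (so $F^{-1}=0$), together with two subcomplexes $E^*\subset F^*$ and $I^*\subset F^*$ such that (A) the inclusion induces $H^k(E^* )\cong H^k(F^* )$ for $k=0,1,\dots$, and (B) $E^k\cap I^k=\{0\}$ for $k=1,2,\dots$. A homological spark of degree $k$ is an element $a\in F^k$ with $da=\phi-r$ for some $\phi\in E^{k+1}$ and $r\in I^{k+1}$. Such $\phi$ and $r$ are uniquely determined by $a$ and satisfy $d\phi=0$, $dr=0$. Two sparks of degree $k$ are equivalent if their difference is of the form $db+s$ with $b\in F^{k-1}$ and $s\in I^k$. $\widehat{\mathbf H}^k$ is the group of equivalence classes $\hat a$ of sparks $a$ of degree $k$. Set $\delta_1\hat a=\phi\in E^{k+1}$ and $\delta_2\hat a=[r]\in H^{k+1}(I^* )$; these depend only on $\hat a$. Notation: $Z^k_I(E^* )$ is the group of cycles ($d$-closed elements) $\phi\in E^k$ which are homologous in $F^*$ to some ($d$-closed) $r\in I^k$. $H^k_I(F^* )$ is the image, and $H^k(F^*,I^* )$ the kernel, of the map $H^k(I^* )\to H^k(F^* )$ induced by inclusion. $\widehat{\mathbf H}^k_E\subset\widehat{\mathbf H}^k$ is the subgroup of spark classes that can be represented by a spark $a\in E^k$ (so $\widehat{\mathbf H}^k_E\cong E^k/Z^k_I(E^* )$). $H^k(F^*/I^* )$ is the cohomology of the quotient complex. Maps of the diagram. In the first row: the left map sends the class of a closed element of $E^k$ (using $H^k(E^* )\cong H^k(F^* )$)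 to its spark class; the right map is $\delta_1$ (i.e. $\hat a\mapsto da$ for $a\in E^k$). In the second row: the left map sends the class of $a\in F^k$ with $da\in I^{k+1}$ to its spark class $\hat a$; the right map is $\delta_1$. In the third row: the left map is inclusion of the kernel, the right map is the one induced by $I^*\subset F^*$. In the left column: the first map is induced by $F^*\to F^*/I^*$, and the second, $\delta_2$, sends the class of $a$ with $da=-r$, $r\in I^{k+1}$, to $[r]$. In the middle column: inclusion, followed by $\delta_2$. In the right column: inclusion, followed by the map sending $\phi$ to its class in $H^{k+1}(F^* )$. *)

theory Defs
  imports "HOL-Algebra.Elementary_Groups"
begin

text \<open>
  Abelian groups are HOL-Algebra commutative groups and hence written multiplicatively:
  a difference x - y reads x \<otimes> inv y, and 0 reads \<one>.
\<close>

section \<open>Cochain complexes\<close>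

locale cochain_complex =
  fixes C :: "nat \<Rightarrow> ('a, 'm) monoid_scheme"
    and d :: "nat \<Rightarrow> 'a \<Rightarrow> 'a"
  assumes comm_group: "comm_group (C k)"
    and d_hom: "d k \<in> hom (C k) (C (Suc k))"
    and d_d: "x \<in> carrier (C k) \<Longrightarrow> d (Suc k) (d k x) = \<one>\<^bsub>C (Suc (Suc k))\<^esub>"

definition cocycles :: "(nat \<Rightarrow> ('a, 'm) monoid_scheme) \<Rightarrow> (nat \<Rightarrow> 'a \<Rightarrow> 'a) \<Rightarrow> nat \<Rightarrow> 'a set"
  where "cocycles C d k = kernel (C k) (C (Suc k)) (d k)"

text \<open>The case k = 0 is the convention that the group in degree -1 is 0.\<close>

definition coboundaries :: "(nat \<Rightarrow> ('a, 'm) monoid_scheme) \<Rightarrow> (nat \<Rightarrow> 'a \<Rightarrow> 'a) \<Rightarrow> nat \<Rightarrow> 'a set"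
  where "coboundaries C d k =
    (case k of 0 \<Rightarrow> {\<one>\<^bsub>C 0\<^esub>} | Suc j \<Rightarrow> d j ` carrier (C j))"

definition cohomology :: "(nat \<Rightarrow> ('a, 'm) monoid_scheme) \<Rightarrow> (nat \<Rightarrow> 'a \<Rightarrow> 'a) \<Rightarrow> nat \<Rightarrow> 'a set monoid"
  where "cohomology C d k = (C k)\<lparr>carrier := cocycles C d k\<rparr> Mod coboundaries C d k"

definition cohomology_class :: "(nat \<Rightarrow> ('a, 'm) monoid_scheme) \<Rightarrow> (nat \<Rightarrow> 'a \<Rightarrow> 'a) \<Rightarrow> nat \<Rightarrow> 'a \<Rightarrow> 'a set"
  where "cohomology_class C d k x = coboundaries C d k #>\<^bsub>C k\<^esub> x"

text \<open>
  The map on k-th cohomology induced by the degree-k component f of a cochain map into (D, d').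
  Maps on quotients are given, as elsewhere in HOL-Algebra, by applying the_elem to the
  (singleton) set of the values at all representatives.
\<close>

definition cohomology_map ::
    "(nat \<Rightarrow> ('b, 'n) monoid_scheme) \<Rightarrow> (nat \<Rightarrow> 'b \<Rightarrow> 'b) \<Rightarrow> nat \<Rightarrow> ('a \<Rightarrow> 'b) \<Rightarrow> 'a set \<Rightarrow> 'b set"
  where "cohomology_map D d' k f c = the_elem ((\<lambda>x. cohomology_class D d' k (f x)) ` c)"

definition subcomplex :: "(nat \<Rightarrow> ('a, 'm) monoid_scheme) \<Rightarrow> (nat \<Rightarrow> 'a \<Rightarrow> 'a) \<Rightarrow> (nat \<Rightarrow> 'a set) \<Rightarrow> bool"
  where "subcomplex C d S \<longleftrightarrow> (\<forall>k. subgroup (S k) (C k) \<and> d k ` S k \<subseteq> S (Suc k))"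

definition sub_complex :: "(nat \<Rightarrow> ('a, 'm) monoid_scheme) \<Rightarrow> (nat \<Rightarrow> 'a set) \<Rightarrow> nat \<Rightarrow> ('a, 'm) monoid_scheme"
  where "sub_complex C S k = (C k)\<lparr>carrier := S k\<rparr>"

definition quot_complex :: "(nat \<Rightarrow> ('a, 'm) monoid_scheme) \<Rightarrow> (nat \<Rightarrow> 'a set) \<Rightarrow> nat \<Rightarrow> 'a set monoid"
  where "quot_complex C S k = C k Mod S k"

definition quot_d ::
    "(nat \<Rightarrow> ('a, 'm) monoid_scheme) \<Rightarrow> (nat \<Rightarrow> 'a \<Rightarrow> 'a) \<Rightarrow> (nat \<Rightarrow> 'a set) \<Rightarrow> nat \<Rightarrow> 'a set \<Rightarrow> 'a set"
  where "quot_d C d S k A = the_elem ((\<lambda>a. S (Suc k) #>\<^bsub>C (Suc k)\<^esub> d k a) ` A)"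

text \<open>
  Exactness of 0 -> A -> B -> C -> 0. The library's \<open>short_exact_sequence\<close> requires all groups
  to have the same element type.
\<close>

definition short_exact ::
    "('a, 'l) monoid_scheme \<Rightarrow> ('a \<Rightarrow> 'b) \<Rightarrow> ('b, 'm) monoid_scheme \<Rightarrow> ('b \<Rightarrow> 'c) \<Rightarrow> ('c, 'n) monoid_scheme \<Rightarrow> bool"
  where "short_exact A f B g C \<longleftrightarrow>
    group A \<and> group B \<and> group C \<and> f \<in> hom A B \<and> g \<in> hom B C \<and>
    kernel A B f = {\<one>\<^bsub>A\<^esub>} \<and>
    f ` carrier A = kernel B C g \<and>
    g ` carrier B = carrier C"


section \<open>Spark complexes\<close>

locale spark_complex = cochain_complex F d
  for F :: "nat \<Rightarrow> ('a, 'm) monoid_scheme" and d :: "nat \<Rightarrow> 'a \<Rightarrow> 'a" +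
  fixes E I :: "nat \<Rightarrow> 'a set"
  assumes subcomplex_E: "subcomplex F d E"
    and subcomplex_I: "subcomplex F d I"
    and cohomology_iso:
      "cohomology_map F d k id \<in> iso (cohomology (sub_complex F E) d k) (cohomology F d k)"
    and E_Int_I: "k \<ge> 1 \<Longrightarrow> E k \<inter> I k = {\<one>\<^bsub>F k\<^esub>}"

definition sparks ::
    "(nat \<Rightarrow> ('a, 'm) monoid_scheme) \<Rightarrow> (nat \<Rightarrow> 'a \<Rightarrow> 'a) \<Rightarrow> (nat \<Rightarrow> 'a set) \<Rightarrow> (nat \<Rightarrow> 'a set) \<Rightarrow> nat \<Rightarrow> 'a set"
  where "sparks F d E I k = {a \<in> carrier (F k).
    \<exists>\<phi>\<in>E (Suc k). \<exists>r\<in>I (Suc k). d k a = \<phi> \<otimes>\<^bsub>F (Suc k)\<^esub> inv\<^bsub>F (Suc k)\<^esub> r}"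

text \<open>The elements db + s.\<close>

definition null_sparks ::
    "(nat \<Rightarrow> ('a, 'm) monoid_scheme) \<Rightarrow> (nat \<Rightarrow> 'a \<Rightarrow> 'a) \<Rightarrow> (nat \<Rightarrow> 'a set) \<Rightarrow> nat \<Rightarrow> 'a set"
  where "null_sparks F d I k = coboundaries F d k <#>\<^bsub>F k\<^esub> I k"

definition spark_group ::
    "(nat \<Rightarrow> ('a, 'm) monoid_scheme) \<Rightarrow> (nat \<Rightarrow> 'a \<Rightarrow> 'a) \<Rightarrow> (nat \<Rightarrow> 'a set) \<Rightarrow> (nat \<Rightarrow> 'a set) \<Rightarrow> nat \<Rightarrow> 'a set monoid"
  where "spark_group F d E I k = (F k)\<lparr>carrier := sparks F d E I k\<rparr> Mod null_sparks F d I k"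

definition spark_class ::
    "(nat \<Rightarrow> ('a, 'm) monoid_scheme) \<Rightarrow> (nat \<Rightarrow> 'a \<Rightarrow> 'a) \<Rightarrow> (nat \<Rightarrow> 'a set) \<Rightarrow> nat \<Rightarrow> 'a \<Rightarrow> 'a set"
  where "spark_class F d I k a = null_sparks F d I k #>\<^bsub>F k\<^esub> a"

definition spark_group_E ::
    "(nat \<Rightarrow> ('a, 'm) monoid_scheme) \<Rightarrow> (nat \<Rightarrow> 'a \<Rightarrow> 'a) \<Rightarrow> (nat \<Rightarrow> 'a set) \<Rightarrow> (nat \<Rightarrow> 'a set) \<Rightarrow> nat \<Rightarrow> 'a set monoid"
  where "spark_group_E F d E I k =
    (spark_group F d E I k)\<lparr>carrier := {A \<in> carrier (spark_group F d E I k). A \<inter> E k \<noteq> {}}\<rparr>"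

definition delta1 ::
    "(nat \<Rightarrow> ('a, 'm) monoid_scheme) \<Rightarrow> (nat \<Rightarrow> 'a \<Rightarrow> 'a) \<Rightarrow> (nat \<Rightarrow> 'a set) \<Rightarrow> (nat \<Rightarrow> 'a set) \<Rightarrow> nat \<Rightarrow> 'a set \<Rightarrow> 'a"
  where "delta1 F d E I k A = the_elem {\<phi> \<in> E (Suc k).
    \<exists>a\<in>A. \<exists>r\<in>I (Suc k). d k a = \<phi> \<otimes>\<^bsub>F (Suc k)\<^esub> inv\<^bsub>F (Suc k)\<^esub> r}"

definition delta2 ::
    "(nat \<Rightarrow> ('a, 'm) monoid_scheme) \<Rightarrow> (nat \<Rightarrow> 'a \<Rightarrow> 'a) \<Rightarrow> (nat \<Rightarrow> 'a set) \<Rightarrow> (nat \<Rightarrow> 'a set) \<Rightarrow> nat \<Rightarrow> 'a set \<Rightarrow> 'a set"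
  where "delta2 F d E I k A = the_elem (cohomology_class (sub_complex F I) d (Suc k) ` {r \<in> I (Suc k).
    \<exists>a\<in>A. \<exists>\<phi>\<in>E (Suc k). d k a = \<phi> \<otimes>\<^bsub>F (Suc k)\<^esub> inv\<^bsub>F (Suc k)\<^esub> r})"


section \<open>The remaining groups of the diagram\<close>

definition Z_I ::
    "(nat \<Rightarrow> ('a, 'm) monoid_scheme) \<Rightarrow> (nat \<Rightarrow> 'a \<Rightarrow> 'a) \<Rightarrow> (nat \<Rightarrow> 'a set) \<Rightarrow> (nat \<Rightarrow> 'a set) \<Rightarrow> nat \<Rightarrow> ('a, 'm) monoid_scheme"
  where "Z_I F d E I k = (F k)\<lparr>carrier := {\<phi> \<in> cocycles (sub_complex F E) d k.
    \<exists>r \<in> cocycles (sub_complex F I) d k. \<phi> \<otimes>\<^bsub>F k\<^esub> inv\<^bsub>F k\<^esub> r \<in> coboundaries F d k}\<rparr>"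

definition dE ::
    "(nat \<Rightarrow> ('a, 'm) monoid_scheme) \<Rightarrow> (nat \<Rightarrow> 'a \<Rightarrow> 'a) \<Rightarrow> (nat \<Rightarrow> 'a set) \<Rightarrow> nat \<Rightarrow> ('a, 'm) monoid_scheme"
  where "dE F d E k = (F (Suc k))\<lparr>carrier := d k ` E k\<rparr>"

definition H_I ::
    "(nat \<Rightarrow> ('a, 'm) monoid_scheme) \<Rightarrow> (nat \<Rightarrow> 'a \<Rightarrow> 'a) \<Rightarrow> (nat \<Rightarrow> 'a set) \<Rightarrow> nat \<Rightarrow> 'a set monoid"
  where "H_I F d I k = (cohomology F d k)\<lparr>carrier :=
    cohomology_map F d k id ` carrier (cohomology (sub_complex F I) d k)\<rparr>"

text \<open>The group written H^k(F,I) in the diagram.\<close>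

definition H_ker ::
    "(nat \<Rightarrow> ('a, 'm) monoid_scheme) \<Rightarrow> (nat \<Rightarrow> 'a \<Rightarrow> 'a) \<Rightarrow> (nat \<Rightarrow> 'a set) \<Rightarrow> nat \<Rightarrow> 'a set monoid"
  where "H_ker F d I k = (cohomology (sub_complex F I) d k)\<lparr>carrier :=
    kernel (cohomology (sub_complex F I) d k) (cohomology F d k) (cohomology_map F d k id)\<rparr>"

definition H_mod_H_I ::
    "(nat \<Rightarrow> ('a, 'm) monoid_scheme) \<Rightarrow> (nat \<Rightarrow> 'a \<Rightarrow> 'a) \<Rightarrow> (nat \<Rightarrow> 'a set) \<Rightarrow> nat \<Rightarrow> 'a set set monoid"
  where "H_mod_H_I F d I k = cohomology F d k Mod carrier (H_I F d I k)"

definition H_mod_H_I_class ::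
    "(nat \<Rightarrow> ('a, 'm) monoid_scheme) \<Rightarrow> (nat \<Rightarrow> 'a \<Rightarrow> 'a) \<Rightarrow> (nat \<Rightarrow> 'a set) \<Rightarrow> nat \<Rightarrow> 'a \<Rightarrow> 'a set set"
  where "H_mod_H_I_class F d I k a =
    carrier (H_I F d I k) #>\<^bsub>cohomology F d k\<^esub> cohomology_class F d k a"

definition H_quot ::
    "(nat \<Rightarrow> ('a, 'm) monoid_scheme) \<Rightarrow> (nat \<Rightarrow> 'a \<Rightarrow> 'a) \<Rightarrow> (nat \<Rightarrow> 'a set) \<Rightarrow> nat \<Rightarrow> 'a set set monoid"
  where "H_quot F d I k = cohomology (quot_complex F I) (quot_d F d I) k"

definition H_quot_class ::
    "(nat \<Rightarrow> ('a, 'm) monoid_scheme) \<Rightarrow> (nat \<Rightarrow> 'a \<Rightarrow> 'a) \<Rightarrow> (nat \<Rightarrow> 'a set) \<Rightarrow> nat \<Rightarrow> 'a \<Rightarrow> 'a set set"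
  where "H_quot_class F d I k a =
    cohomology_class (quot_complex F I) (quot_d F d I) k (I k #>\<^bsub>F k\<^esub> a)"


section \<open>The remaining maps of the diagram\<close>

text \<open>
  First row: the value at c is the spark class of those closed elements of E that represent c;
  that each c has such a representative is part of the hypothesis on H(E) and H(F).
\<close>

definition H_mod_H_I_to_sparks ::
    "(nat \<Rightarrow> ('a, 'm) monoid_scheme) \<Rightarrow> (nat \<Rightarrow> 'a \<Rightarrow> 'a) \<Rightarrow> (nat \<Rightarrow> 'a set) \<Rightarrow> (nat \<Rightarrow> 'a set) \<Rightarrow> nat \<Rightarrow> 'a set set \<Rightarrow> 'a set"
  where "H_mod_H_I_to_sparks F d E I k c = the_elem (spark_class F d I k `
    {a \<in> cocycles (sub_complex F E) d k. H_mod_H_I_class F d I k a = c})"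

definition H_quot_to_sparks ::
    "(nat \<Rightarrow> ('a, 'm) monoid_scheme) \<Rightarrow> (nat \<Rightarrow> 'a \<Rightarrow> 'a) \<Rightarrow> (nat \<Rightarrow> 'a set) \<Rightarrow> nat \<Rightarrow> 'a set set \<Rightarrow> 'a set"
  where "H_quot_to_sparks F d I k c = the_elem (spark_class F d I k `
    {a \<in> carrier (F k). d k a \<in> I (Suc k) \<and> H_quot_class F d I k a = c})"

text \<open>
  Left column. The argument of the first map is a coset of classes in H(F), to each of which the
  map induced by the projection F -> F/I is applied.
\<close>

definition H_mod_H_I_to_H_quot ::
    "(nat \<Rightarrow> ('a, 'm) monoid_scheme) \<Rightarrow> (nat \<Rightarrow> 'a \<Rightarrow> 'a) \<Rightarrow> (nat \<Rightarrow> 'a set) \<Rightarrow> nat \<Rightarrow> 'a set set \<Rightarrow> 'a set set"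
  where "H_mod_H_I_to_H_quot F d I k c =
    the_elem (cohomology_map (quot_complex F I) (quot_d F d I) k (\<lambda>a. I k #>\<^bsub>F k\<^esub> a) ` c)"

definition delta2_quot ::
    "(nat \<Rightarrow> ('a, 'm) monoid_scheme) \<Rightarrow> (nat \<Rightarrow> 'a \<Rightarrow> 'a) \<Rightarrow> (nat \<Rightarrow> 'a set) \<Rightarrow> nat \<Rightarrow> 'a set set \<Rightarrow> 'a set"
  where "delta2_quot F d I k c = the_elem (cohomology_class (sub_complex F I) d (Suc k) ` {r \<in> I (Suc k).
    \<exists>a\<in>carrier (F k). d k a = inv\<^bsub>F (Suc k)\<^esub> r \<and> H_quot_class F d I k a = c})"

end

theory Submission
  imports Defs
begin

text \<open>
  The maps of the diagram are all described on representatives, and the proof computes with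
  representatives throughout (comments write the groups additively). Three subgroups of \<open>F k\<close> carry
  the argument: the sparks, the elements a with da in I, and the cocycles. They represent the spark
  group, H(F/I) and H(F)/H_I(F), and in all three cases an element represents zero if and only if it
  has the form db + s with s in I (lemmas \<open>spark_class_eq_one_iff\<close>,
  \<open>H_quot_class_eq_one_iff\<close>, \<open>H_mod_H_I_class_eq_one_iff\<close>). So the maps between these groups are
  injective, and the maps out of them can be computed on any representative.

  Since E and I meet only in zero in positive degrees, the decomposition \<open>da = \<phi> - r\<close> of a spark is
  unique (\<open>decomposition_unique\<close>), and applying d to it shows that \<open>\<phi>\<close> and r are closed. A null
  spark db + s has differential ds, so changing a spark a within its class leaves \<open>\<phi>\<close> fixed and
  changes r by the differential of an element of I (\<open>decomposes_spark_class\<close>). Hence \<open>\<delta>\<^sub>1\<close> and \<open>\<delta>\<^sub>2\<close>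
  are well defined with values \<open>\<phi>\<close> and [r], and the squares of the diagram commute by inspection;
  the last one because \<open>\<phi> - r\<close> is the coboundary da.

  Each row and column then has the form X -> Y -> C for subgroups X of Y of one group, passed to
  quotients, and \<open>short_exact_presented\<close> reduces its exactness to elements. What remains is to
  recognise kernels and images. The isomorphism of H(E) with H(F) enters in two ways. Every cocycle
  of F is cohomologous to a cocycle of E (\<open>cocycle_cohomologous_E\<close>): a closed r in I thus
  differs from some closed e in E by a coboundary, so r occurs as the I-part of a spark and
  \<open>\<delta>\<^sub>2\<close> is surjective. And an element of E that bounds in F bounds in E (\<open>coboundary_in_E\<close>).
  Together they show that a spark a with r = ds has a representative in E: a + s has differential
  \<open>\<phi>\<close>, which is de for some e in E, and the cocycle a + s - e is cohomologous to an element of E.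
\<close>


section \<open>Surjective homomorphisms and presentations of short exact sequences\<close>

text \<open>
  A surjective homomorphism. Preservation of the unit is required so that nothing need be assumed of
  the target: it is then a group if the source is one.
\<close>

definition surj_hom :: "('a, 'l) monoid_scheme \<Rightarrow> ('a \<Rightarrow> 'b) \<Rightarrow> ('b, 'm) monoid_scheme \<Rightarrow> bool"
  where "surj_hom G p H \<longleftrightarrow> p \<in> hom G H \<and> p ` carrier G = carrier H \<and> p \<one>\<^bsub>G\<^esub> = \<one>\<^bsub>H\<^esub>"

lemma surj_homD:
  assumes "surj_hom G p H"
  shows "p \<in> hom G H" "p ` carrier G = carrier H" "p \<one>\<^bsub>G\<^esub> = \<one>\<^bsub>H\<^esub>"
  using assms by (auto simp: surj_hom_def)

lemma surj_homI:
  assumes "\<And>x y. \<lbrakk>x \<in> carrier G; y \<in> carrier G\<rbrakk> \<Longrightarrow> p (x \<otimes>\<^bsub>G\<^esub> y) = p x \<otimes>\<^bsub>H\<^esub> p y"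
    and "p ` carrier G = carrier H" and "p \<one>\<^bsub>G\<^esub> = \<one>\<^bsub>H\<^esub>"
  shows "surj_hom G p H"
  using assms by (auto simp: surj_hom_def hom_def)

lemma surj_hom_mult:
  "\<lbrakk>surj_hom G p H; x \<in> carrier G; y \<in> carrier G\<rbrakk> \<Longrightarrow> p (x \<otimes>\<^bsub>G\<^esub> y) = p x \<otimes>\<^bsub>H\<^esub> p y"
  by (auto simp: surj_hom_def hom_def)

lemma surj_hom_group:
  assumes "surj_hom G p H" and "group G"
  shows "group H"
proof -
  have "group (H\<lparr>carrier := p ` carrier G, one := p \<one>\<^bsub>G\<^esub>\<rparr>)"
    using assms by (intro group.hom_imp_img_group) (auto simp: surj_hom_def)
  then show ?thesis
    using surj_homD[OF assms(1)] by simp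
qed

lemma surj_hom_comm_group:
  assumes "surj_hom G p H" and "comm_group G"
  shows "comm_group H"
proof -
  have "comm_group (H\<lparr>carrier := p ` carrier G, one := p \<one>\<^bsub>G\<^esub>\<rparr>)"
    using assms surj_hom_group[OF assms(1)]
    by (intro comm_group.hom_imp_img_comm_group)
      (auto simp: surj_hom_def comm_group_def dest: group.is_monoid)
  then show ?thesis
    using surj_homD[OF assms(1)] by simp
qed

lemma surj_hom_comp:
  assumes "surj_hom G p H" and "surj_hom H q K"
  shows "surj_hom G (\<lambda>x. q (p x)) K"
  using assms by (auto simp: surj_hom_def hom_def Pi_iff image_iff) (metis image_iff)

lemma surj_hom_restrict:
  assumes "surj_hom G p H" and "X \<subseteq> carrier G" and "p ` X = Y"
  shows "surj_hom (G\<lparr>carrier := X\<rparr>) p (H\<lparr>carrier := Y\<rparr>)"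
  using assms by (auto simp: surj_hom_def hom_def subset_iff)

lemma (in comm_group) subgroup_comm_group:
  assumes "subgroup H G"
  shows "comm_group (G\<lparr>carrier := H\<rparr>)"
  using subgroup.mem_carrier[OF assms]
  by (intro group.group_comm_groupI subgroup.subgroup_is_group[OF assms is_group])
    (simp add: m_comm)

lemma (in comm_group) coset_eq_iff:
  assumes "subgroup B G" and "x \<in> carrier G" and "y \<in> carrier G"
  shows "B #> x = B #> y \<longleftrightarrow> x \<otimes> inv y \<in> B"
  by (metis assms is_group rcos_self repr_independence subgroup.rcos_module)

lemma (in comm_group) surj_hom_quotient:
  assumes B: "subgroup B G" and Z: "subgroup Z G"
  shows "surj_hom (G\<lparr>carrier := Z\<rparr>) (\<lambda>x. B #> x) (G\<lparr>carrier := Z\<rparr> Mod B)"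
proof (rule surj_homI)
  interpret B: normal B G
    using B by (rule subgroup_imp_normal)
  have ZG: "Z \<subseteq> carrier G"
    using Z by (rule subgroup.subset)
  show "B #> (x \<otimes>\<^bsub>G\<lparr>carrier := Z\<rparr>\<^esub> y) = (B #> x) \<otimes>\<^bsub>G\<lparr>carrier := Z\<rparr> Mod B\<^esub> (B #> y)"
    if "x \<in> carrier (G\<lparr>carrier := Z\<rparr>)" and "y \<in> carrier (G\<lparr>carrier := Z\<rparr>)" for x y
    using that ZG B.rcos_sum[of x y] by (simp add: subset_iff)
  show "(\<lambda>x. B #> x) ` carrier (G\<lparr>carrier := Z\<rparr>) = carrier (G\<lparr>carrier := Z\<rparr> Mod B)"
    by (simp add: carrier_FactGroup r_coset_def)
  show "B #> \<one>\<^bsub>G\<lparr>carrier := Z\<rparr>\<^esub> = \<one>\<^bsub>G\<lparr>carrier := Z\<rparr> Mod B\<^esub>"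
    using B.subset by simp
qed

lemma surj_hom_cong:
  assumes "surj_hom G p H" and "group G" and "\<And>x. x \<in> carrier G \<Longrightarrow> q x = p x"
  shows "surj_hom G q H"
proof (rule surj_homI)
  interpret group G by fact
  show "q (x \<otimes>\<^bsub>G\<^esub> y) = q x \<otimes>\<^bsub>H\<^esub> q y" if "x \<in> carrier G" "y \<in> carrier G" for x y
    using that surj_hom_mult[OF assms(1)] by (simp add: assms(3))
  show "q ` carrier G = carrier H"
    using surj_homD(2)[OF assms(1)] by (simp add: assms(3))
  show "q \<one>\<^bsub>G\<^esub> = \<one>\<^bsub>H\<^esub>"
    using surj_homD(3)[OF assms(1)] by (simp add: assms(3))
qed

lemma surj_hom_subgroup_image:
  assumes "surj_hom G p H" and "group G" and "subgroup X G"
  shows "subgroup (p ` X) H"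
proof -
  have "group_hom G H p"
    using assms surj_hom_group[OF assms(1,2)]
    by (simp add: group_hom_def group_hom_axioms_def surj_hom_def)
  then show ?thesis
    using assms(3) by (rule group_hom.subgroup_img_is_subgroup)
qed

lemma (in group) surj_hom_eq_iff:
  assumes X: "subgroup X G" and p: "surj_hom (G\<lparr>carrier := X\<rparr>) p H" and xy: "x \<in> X" "y \<in> X"
  shows "p x = p y \<longleftrightarrow> p (x \<otimes> inv y) = \<one>\<^bsub>H\<^esub>"
proof -
  interpret X: group "G\<lparr>carrier := X\<rparr>"
    using X is_group by (rule subgroup.subgroup_is_group)
  interpret H: group H
    using p X.is_group by (rule surj_hom_group)
  interpret p: group_hom "G\<lparr>carrier := X\<rparr>" H p
    using p by unfold_locales (rule surj_homD)
  have cl: "p x \<in> carrier H" "p y \<in> carrier H"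
    using p.hom_closed xy by simp_all
  have "p (x \<otimes> inv y) = p x \<otimes>\<^bsub>H\<^esub> inv\<^bsub>H\<^esub> p y"
    using p.hom_mult[of x "inv y"] p.hom_inv[of y] xy X
    by (simp add: m_inv_consistent subgroup.m_inv_closed)
  then show ?thesis
    using cl H.inv_solve_right'[of "\<one>\<^bsub>H\<^esub>" "p x" "p y"] by simp
qed

text \<open>
  Here subgroups X \<open>\<subseteq>\<close> Y of one group G represent the elements of A and B, the map f is induced by
  the inclusion of X in Y, and g is known through its values on the representatives. That f and g
  are homomorphisms is part of the conclusion.
\<close>

lemma (in group) short_exact_presented:
  assumes X: "subgroup X G" and Y: "subgroup Y G" and XY: "X \<subseteq> Y"
    and p: "surj_hom (G\<lparr>carrier := X\<rparr>) p A"
    and q: "surj_hom (G\<lparr>carrier := Y\<rparr>) q B"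
    and gq: "surj_hom (G\<lparr>carrier := Y\<rparr>) (\<lambda>y. g (q y)) C"
    and fp: "\<And>x. x \<in> X \<Longrightarrow> f (p x) = q x"
    and inj: "\<And>x. \<lbrakk>x \<in> X; q x = \<one>\<^bsub>B\<^esub>\<rbrakk> \<Longrightarrow> p x = \<one>\<^bsub>A\<^esub>"
    and zero: "\<And>x. x \<in> X \<Longrightarrow> g (q x) = \<one>\<^bsub>C\<^esub>"
    and exact: "\<And>y. \<lbrakk>y \<in> Y; g (q y) = \<one>\<^bsub>C\<^esub>\<rbrakk> \<Longrightarrow> \<exists>x\<in>X. q x = q y"
  shows "short_exact A f B g C"
proof -
  have GX: "group (G\<lparr>carrier := X\<rparr>)" and GY: "group (G\<lparr>carrier := Y\<rparr>)"
    using X Y by (simp_all add: subgroup.subgroup_is_group is_group)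
  have A: "group A" and B: "group B" and C: "group C"
    using surj_hom_group[OF p GX] surj_hom_group[OF q GY] surj_hom_group[OF gq GY] by simp_all
  have cA: "carrier A = p ` X" and cB: "carrier B = q ` Y" and cC: "carrier C = (\<lambda>y. g (q y)) ` Y"
    using surj_homD(2)[OF p] surj_homD(2)[OF q] surj_homD(2)[OF gq] by simp_all
  have pm: "p (x \<otimes> y) = p x \<otimes>\<^bsub>A\<^esub> p y" if "x \<in> X" "y \<in> X" for x y
    using surj_hom_mult[OF p] that by simp
  have qm: "q (x \<otimes> y) = q x \<otimes>\<^bsub>B\<^esub> q y" if "x \<in> Y" "y \<in> Y" for x y
    using surj_hom_mult[OF q] that by simp
  have gm: "g (q (x \<otimes> y)) = g (q x) \<otimes>\<^bsub>C\<^esub> g (q y)" if "x \<in> Y" "y \<in> Y" for x y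
    using surj_hom_mult[OF gq] that by simp
  have f: "f \<in> hom A B"
  proof (rule homI)
    fix a assume "a \<in> carrier A"
    then show "f a \<in> carrier B"
      using XY by (auto simp: cA cB fp)
  next
    fix a b assume "a \<in> carrier A" and "b \<in> carrier A"
    then obtain x y where xy: "x \<in> X" "y \<in> X" and ab: "a = p x" "b = p y"
      by (auto simp: cA)
    have "f (a \<otimes>\<^bsub>A\<^esub> b) = q (x \<otimes> y)"
      using xy by (simp add: ab subgroup.m_closed[OF X] fp flip: pm)
    then show "f (a \<otimes>\<^bsub>A\<^esub> b) = f a \<otimes>\<^bsub>B\<^esub> f b"
      using xy XY by (simp add: ab fp qm subset_iff)
  qed
  have g: "g \<in> hom B C"
    by (rule homI) (auto simp: cB cC gm simp flip: qm)
  have "p \<one> = \<one>\<^bsub>A\<^esub>" and "q \<one> = \<one>\<^bsub>B\<^esub>"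
    using surj_homD(3)[OF p] surj_homD(3)[OF q] by simp_all
  then have "f \<one>\<^bsub>A\<^esub> = \<one>\<^bsub>B\<^esub>"
    using fp[OF subgroup.one_closed[OF X]] by simp
  then have kf: "kernel A B f = {\<one>\<^bsub>A\<^esub>}"
    using group.is_monoid[OF A, THEN monoid.one_closed] by (auto simp: kernel_def cA fp inj)
  have "f ` carrier A = q ` X"
    using fp by (force simp: cA)
  also have "\<dots> = kernel B C g"
  proof
    show "q ` X \<subseteq> kernel B C g"
      using XY by (auto simp: kernel_def cB zero)
    show "kernel B C g \<subseteq> q ` X"
    proof
      fix b assume "b \<in> kernel B C g"
      then obtain y where "y \<in> Y" and "b = q y" and "g (q y) = \<one>\<^bsub>C\<^esub>"
        by (auto simp: kernel_def cB)
      then show "b \<in> q ` X"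
        using exact by (metis imageI)
    qed
  qed
  finally have "f ` carrier A = kernel B C g" .
  moreover have "g ` carrier B = carrier C"
    by (force simp: cB cC)
  ultimately show ?thesis
    using A B C f g kf by (simp add: short_exact_def)
qed


section \<open>Cochain complexes, subcomplexes and quotient complexes\<close>

context cochain_complex
begin

sublocale grp: comm_group "C k" for k
  by (rule comm_group)

sublocale d: group_hom "C k" "C (Suc k)" "d k" for k
  by unfold_locales (rule d_hom)

lemma cocycles_iff: "x \<in> cocycles C d k \<longleftrightarrow> x \<in> carrier (C k) \<and> d k x = \<one>\<^bsub>C (Suc k)\<^esub>"
  by (simp add: cocycles_def kernel_def)

lemma subgroup_cocycles: "subgroup (cocycles C d k) (C k)"
  unfolding cocycles_def by (rule d.subgroup_kernel)

lemma subgroup_coboundaries: "subgroup (coboundaries C d k) (C k)"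
  by (cases k) (simp_all add: coboundaries_def grp.triv_subgroup
      d.subgroup_img_is_subgroup[OF grp.subgroup_self])

lemma coboundaries_subset_cocycles: "coboundaries C d k \<subseteq> cocycles C d k"
  by (cases k) (auto simp: coboundaries_def cocycles_iff d_d)

lemma coboundaries_carrier: "x \<in> coboundaries C d k \<Longrightarrow> x \<in> carrier (C k)"
  and coboundaries_closed: "x \<in> coboundaries C d k \<Longrightarrow> d k x = \<one>\<^bsub>C (Suc k)\<^esub>"
  using coboundaries_subset_cocycles[of k] by (auto simp: cocycles_iff)

lemma surj_hom_cohomology_class:
  "surj_hom (C k\<lparr>carrier := cocycles C d k\<rparr>) (cohomology_class C d k) (cohomology C d k)"
  using grp.surj_hom_quotient[OF subgroup_coboundaries subgroup_cocycles]
  by (simp add: cohomology_def cohomology_class_def[abs_def])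

lemma carrier_cohomology: "carrier (cohomology C d k) = cohomology_class C d k ` cocycles C d k"
  using surj_homD(2)[OF surj_hom_cohomology_class] by simp

lemma comm_group_cohomology: "comm_group (cohomology C d k)"
  using surj_hom_cohomology_class grp.subgroup_comm_group[OF subgroup_cocycles]
  by (rule surj_hom_comm_group)

lemma cohomology_class_eq_iff:
  assumes "x \<in> carrier (C k)" and "y \<in> carrier (C k)"
  shows "cohomology_class C d k x = cohomology_class C d k y
    \<longleftrightarrow> x \<otimes>\<^bsub>C k\<^esub> inv\<^bsub>C k\<^esub> y \<in> coboundaries C d k"
  using assms unfolding cohomology_class_def
  by (intro grp.coset_eq_iff subgroup_coboundaries)

lemma cohomology_class_eq_one_iff:
  assumes "x \<in> carrier (C k)"
  shows "cohomology_class C d k x = \<one>\<^bsub>cohomology C d k\<^esub> \<longleftrightarrow> x \<in> coboundaries C d k"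
  using cohomology_class_eq_iff[OF assms grp.one_closed] assms
    surj_homD(3)[OF surj_hom_cohomology_class] by simp

end

lemma cohomology_map_class:
  assumes "cochain_complex C d" and "cochain_complex D d'"
    and f: "f \<in> hom (C k) (D k)" and fB: "f ` coboundaries C d k \<subseteq> coboundaries D d' k"
    and x: "x \<in> carrier (C k)"
  shows "cohomology_map D d' k f (cohomology_class C d k x) = cohomology_class D d' k (f x)"
proof -
  interpret C: cochain_complex C d by fact
  interpret D: cochain_complex D d' by fact
  interpret f: group_hom "C k" "D k" f
    using f by unfold_locales
  have self: "x \<in> cohomology_class C d k x"
    using x by (simp add: cohomology_class_def C.grp.rcos_self C.subgroup_coboundaries)
  have "cohomology_class D d' k (f y) = cohomology_class D d' k (f x)"
    if yx: "y \<in> cohomology_class C d k x" for y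
  proof -
    obtain b where b: "b \<in> coboundaries C d k" and y: "y = b \<otimes>\<^bsub>C k\<^esub> x"
      using yx by (auto simp: cohomology_class_def r_coset_def)
    have "f y \<otimes>\<^bsub>D k\<^esub> inv\<^bsub>D k\<^esub> f x = f b"
      using x C.coboundaries_carrier[OF b] by (simp add: y D.grp.m_assoc)
    then show ?thesis
      using x b y fB C.coboundaries_carrier[OF b] by (auto simp: D.cohomology_class_eq_iff)
  qed
  moreover have "cohomology_class C d k x \<noteq> {}"
    using self by blast
  ultimately show ?thesis
    unfolding cohomology_map_def by (intro the_elem_image_unique)
qed

lemma coboundaries_sub_complex:
  "coboundaries (sub_complex C S) d k = (case k of 0 \<Rightarrow> {\<one>\<^bsub>C 0\<^esub>} | Suc j \<Rightarrow> d j ` S j)"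
  by (simp add: coboundaries_def sub_complex_def split: nat.split)

lemma cocycles_sub_complex: "cocycles (sub_complex C S) d k = {x \<in> S k. d k x = \<one>\<^bsub>C (Suc k)\<^esub>}"
  by (simp add: cocycles_def kernel_def sub_complex_def)

lemma (in cochain_complex)
  assumes S: "subcomplex C d S"
  shows cochain_complex_sub: "cochain_complex (sub_complex C S) d"
    and cochain_complex_quot: "cochain_complex (quot_complex C S) (quot_d C d S)"
    and quot_d_coset: "x \<in> carrier (C k) \<Longrightarrow>
      quot_d C d S k (S k #>\<^bsub>C k\<^esub> x) = S (Suc k) #>\<^bsub>C (Suc k)\<^esub> d k x"
proof -
  have sub: "subgroup (S k) (C k)" and dS: "d k ` S k \<subseteq> S (Suc k)" for k
    using S by (auto simp: subcomplex_def)
  have SC: "x \<in> carrier (C k)" if "x \<in> S k" for x k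
    using that subgroup.mem_carrier[OF sub] by blast
  show "cochain_complex (sub_complex C S) d"
  proof (rule cochain_complex.intro)
    show "comm_group (sub_complex C S k)" for k
      unfolding sub_complex_def by (rule grp.subgroup_comm_group[OF sub])
    show "d k \<in> hom (sub_complex C S k) (sub_complex C S (Suc k))" for k
      using dS by (auto simp: hom_def sub_complex_def SC)
    show "d (Suc k) (d k x) = \<one>\<^bsub>sub_complex C S (Suc (Suc k))\<^esub>"
      if "x \<in> carrier (sub_complex C S k)" for k x
      using that by (simp add: sub_complex_def SC d_d)
  qed
  have qd: "quot_d C d S k (S k #>\<^bsub>C k\<^esub> x) = S (Suc k) #>\<^bsub>C (Suc k)\<^esub> d k x"
    if x: "x \<in> carrier (C k)" for k x
    unfolding quot_d_def
  proof (rule the_elem_image_unique)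
    show "S k #>\<^bsub>C k\<^esub> x \<noteq> {}"
      using grp.rcos_self[OF x sub] by blast
    show "S (Suc k) #>\<^bsub>C (Suc k)\<^esub> d k y = S (Suc k) #>\<^bsub>C (Suc k)\<^esub> d k x"
      if yx: "y \<in> S k #>\<^bsub>C k\<^esub> x" for y
    proof -
      obtain s where s: "s \<in> S k" and y: "y = s \<otimes>\<^bsub>C k\<^esub> x"
        using yx by (auto simp: r_coset_def)
      have "d k y \<otimes>\<^bsub>C (Suc k)\<^esub> inv\<^bsub>C (Suc k)\<^esub> d k x = d k s"
        using s x by (simp add: y SC grp.m_assoc)
      then show ?thesis
        using s x dS by (auto simp: y SC grp.coset_eq_iff[OF sub])
    qed
  qed
  then show "x \<in> carrier (C k) \<Longrightarrow>
      quot_d C d S k (S k #>\<^bsub>C k\<^esub> x) = S (Suc k) #>\<^bsub>C (Suc k)\<^esub> d k x" .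
  have car: "carrier (quot_complex C S k) = (\<lambda>x. S k #>\<^bsub>C k\<^esub> x) ` carrier (C k)" for k
    by (simp add: quot_complex_def carrier_FactGroup)
  have mult: "(S k #>\<^bsub>C k\<^esub> x) <#>\<^bsub>C k\<^esub> (S k #>\<^bsub>C k\<^esub> y) = S k #>\<^bsub>C k\<^esub> (x \<otimes>\<^bsub>C k\<^esub> y)"
    if "x \<in> carrier (C k)" "y \<in> carrier (C k)" for x y k
    using that normal.rcos_sum[OF grp.subgroup_imp_normal[OF sub]] by simp
  show "cochain_complex (quot_complex C S) (quot_d C d S)"
  proof (rule cochain_complex.intro)
    show "comm_group (quot_complex C S k)" for k
      unfolding quot_complex_def by (rule grp.abelian_FactGroup[OF sub])
    show "quot_d C d S k \<in> hom (quot_complex C S k) (quot_complex C S (Suc k))" for k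
    proof (rule homI)
      fix A assume "A \<in> carrier (quot_complex C S k)"
      then show "quot_d C d S k A \<in> carrier (quot_complex C S (Suc k))"
        by (auto simp: car qd)
    next
      fix A B assume "A \<in> carrier (quot_complex C S k)" and "B \<in> carrier (quot_complex C S k)"
      then show "quot_d C d S k (A \<otimes>\<^bsub>quot_complex C S k\<^esub> B)
          = quot_d C d S k A \<otimes>\<^bsub>quot_complex C S (Suc k)\<^esub> quot_d C d S k B"
        unfolding car by (auto simp: quot_complex_def mult qd simp del: set_mult_consistent)
    qed
    show "quot_d C d S (Suc k) (quot_d C d S k x) = \<one>\<^bsub>quot_complex C S (Suc (Suc k))\<^esub>"
      if x: "x \<in> carrier (quot_complex C S k)" for k x
    proof -
      obtain y where "y \<in> carrier (C k)" and "x = S k #>\<^bsub>C k\<^esub> y"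
        using x by (auto simp: car)
      then show ?thesis
        using subgroup.subset[OF sub] by (simp add: qd d_d) (simp add: quot_complex_def)
    qed
  qed
qed

lemma (in cochain_complex)
  assumes S: "subcomplex C d S"
  shows cocycles_quot_complex: "cocycles (quot_complex C S) (quot_d C d S) k
      = (\<lambda>x. S k #>\<^bsub>C k\<^esub> x) ` {x \<in> carrier (C k). d k x \<in> S (Suc k)}"
    and coboundaries_quot_complex: "coboundaries (quot_complex C S) (quot_d C d S) k
      = (\<lambda>x. S k #>\<^bsub>C k\<^esub> x) ` coboundaries C d k"
proof -
  have sub: "subgroup (S k) (C k)" for k
    using S by (auto simp: subcomplex_def)
  have coset_one: "S k #>\<^bsub>C k\<^esub> x = S k \<longleftrightarrow> x \<in> S k" if "x \<in> carrier (C k)" for x k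
    using grp.coset_eq_iff[OF sub that grp.one_closed] that subgroup.subset[OF sub] by simp
  show "cocycles (quot_complex C S) (quot_d C d S) k
      = (\<lambda>x. S k #>\<^bsub>C k\<^esub> x) ` {x \<in> carrier (C k). d k x \<in> S (Suc k)}"
  proof -
    have "quot_d C d S k (S k #>\<^bsub>C k\<^esub> x) = \<one>\<^bsub>quot_complex C S (Suc k)\<^esub> \<longleftrightarrow> d k x \<in> S (Suc k)"
      if "x \<in> carrier (C k)" for x
      using that quot_d_coset[OF S] coset_one[of "d k x" "Suc k"] by (simp add: quot_complex_def)
    then show ?thesis
      by (auto simp: cocycles_def kernel_def) (auto simp: quot_complex_def carrier_FactGroup)
  qed
  show "coboundaries (quot_complex C S) (quot_d C d S) k
      = (\<lambda>x. S k #>\<^bsub>C k\<^esub> x) ` coboundaries C d k"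
  proof (cases k)
    case 0
    then show ?thesis
      using subgroup.subset[OF sub] by (simp add: coboundaries_def quot_complex_def)
  next
    case (Suc j)
    have "quot_d C d S j ` carrier (quot_complex C S j)
        = (\<lambda>x. quot_d C d S j (S j #>\<^bsub>C j\<^esub> x)) ` carrier (C j)"
      by (simp add: quot_complex_def carrier_FactGroup image_image)
    also have "\<dots> = (\<lambda>x. S (Suc j) #>\<^bsub>C (Suc j)\<^esub> d j x) ` carrier (C j)"
      by (intro image_cong refl quot_d_coset[OF S])
    finally show ?thesis
      by (simp add: Suc coboundaries_def image_image)
  qed
qed


section \<open>Spark complexes: representatives and decompositions\<close>

context spark_complex
begin

sublocale CE: cochain_complex "sub_complex F E" d
  by (rule cochain_complex_sub[OF subcomplex_E])

sublocale CI: cochain_complex "sub_complex F I" d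
  by (rule cochain_complex_sub[OF subcomplex_I])

sublocale CQ: cochain_complex "quot_complex F I" "quot_d F d I"
  by (rule cochain_complex_quot[OF subcomplex_I])

lemma subgroup_E: "subgroup (E k) (F k)" and d_E: "x \<in> E k \<Longrightarrow> d k x \<in> E (Suc k)"
  using subcomplex_E by (auto simp: subcomplex_def)

lemma subgroup_I: "subgroup (I k) (F k)" and d_I: "x \<in> I k \<Longrightarrow> d k x \<in> I (Suc k)"
  using subcomplex_I by (auto simp: subcomplex_def)

lemma E_carrier: "x \<in> E k \<Longrightarrow> x \<in> carrier (F k)"
  using subgroup_E by (rule subgroup.mem_carrier)

lemma I_carrier: "x \<in> I k \<Longrightarrow> x \<in> carrier (F k)"
  using subgroup_I by (rule subgroup.mem_carrier)

lemma subgroup_cocycles_sub: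
  shows "subgroup (cocycles (sub_complex F E) d k) (F k)"
    and "subgroup (cocycles (sub_complex F I) d k) (F k)"
proof -
  have "cocycles (sub_complex F E) d k = E k \<inter> cocycles F d k"
    and "cocycles (sub_complex F I) d k = I k \<inter> cocycles F d k"
    by (auto simp: cocycles_sub_complex cocycles_iff E_carrier I_carrier)
  then show "subgroup (cocycles (sub_complex F E) d k) (F k)"
    and "subgroup (cocycles (sub_complex F I) d k) (F k)"
    by (simp_all add: grp.subgroups_Inter_pair subgroup_E subgroup_I subgroup_cocycles)
qed

lemma cocycles_E_subset: "cocycles (sub_complex F E) d k \<subseteq> cocycles F d k"
  and cocycles_I_subset: "cocycles (sub_complex F I) d k \<subseteq> cocycles F d k"
  by (auto simp: cocycles_sub_complex cocycles_iff E_carrier I_carrier)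

lemma coboundaries_sub_subset:
  shows "coboundaries (sub_complex F E) d k \<subseteq> coboundaries F d k"
    and "coboundaries (sub_complex F I) d k \<subseteq> coboundaries F d k"
  by (auto simp: coboundaries_sub_complex E_carrier I_carrier split: nat.splits)
    (auto simp: coboundaries_def E_carrier I_carrier)

lemma cohomology_map_E:
  "x \<in> E k \<Longrightarrow> cohomology_map F d k id (cohomology_class (sub_complex F E) d k x)
    = cohomology_class F d k x"
  using cohomology_map_class[OF CE.cochain_complex_axioms cochain_complex_axioms, of id k x]
    coboundaries_sub_subset(1)
  by (simp add: hom_def E_carrier sub_complex_def Pi_iff)

lemma cohomology_map_I:
  "x \<in> I k \<Longrightarrow> cohomology_map F d k id (cohomology_class (sub_complex F I) d k x)
    = cohomology_class F d k x"
  using cohomology_map_class[OF CI.cochain_complex_axioms cochain_complex_axioms, of id k x]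
    coboundaries_sub_subset(2)
  by (simp add: hom_def I_carrier sub_complex_def Pi_iff)

lemma cohomology_class_I_eq_iff:
  assumes "x \<in> I k" and "y \<in> I k"
  shows "cohomology_class (sub_complex F I) d k x = cohomology_class (sub_complex F I) d k y
    \<longleftrightarrow> x \<otimes>\<^bsub>F k\<^esub> inv\<^bsub>F k\<^esub> y \<in> coboundaries (sub_complex F I) d k"
  using CI.cohomology_class_eq_iff[of x k y] assms
  by (simp add: sub_complex_def grp.m_inv_consistent[OF subgroup_I])

lemma cohomology_class_I_eq_one_iff:
  assumes "x \<in> I k"
  shows "cohomology_class (sub_complex F I) d k x = \<one>\<^bsub>cohomology (sub_complex F I) d k\<^esub>
    \<longleftrightarrow> x \<in> coboundaries (sub_complex F I) d k"
  using CI.cohomology_class_eq_one_iff[of x k] assms by (simp add: sub_complex_def)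

lemma surj_hom_class_I:
  "surj_hom (F k\<lparr>carrier := cocycles (sub_complex F I) d k\<rparr>)
    (cohomology_class (sub_complex F I) d k) (cohomology (sub_complex F I) d k)"
  using CI.surj_hom_cohomology_class[of k] by (simp add: sub_complex_def)

text \<open>The surjectivity of H(E) -> H(F), stated for cocycles.\<close>

lemma cocycle_cohomologous_E:
  assumes z: "z \<in> cocycles F d k"
  obtains e where "e \<in> cocycles (sub_complex F E) d k"
    and "z \<otimes>\<^bsub>F k\<^esub> inv\<^bsub>F k\<^esub> e \<in> coboundaries F d k"
proof -
  have "cohomology_map F d k id ` carrier (cohomology (sub_complex F E) d k)
      = carrier (cohomology F d k)"
    using cohomology_iso[of k] by (simp add: iso_def bij_betw_def)
  then obtain e where e: "e \<in> cocycles (sub_complex F E) d k"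
    and eq: "cohomology_map F d k id (cohomology_class (sub_complex F E) d k e) = cohomology_class F d k z"
    using z by (auto simp: carrier_cohomology CE.carrier_cohomology set_eq_iff image_iff) metis
  from e have "e \<in> E k"
    by (simp add: cocycles_sub_complex)
  with eq z have "z \<otimes>\<^bsub>F k\<^esub> inv\<^bsub>F k\<^esub> e \<in> coboundaries F d k"
    by (simp add: cohomology_map_E E_carrier cocycles_iff flip: cohomology_class_eq_iff)
  with e show thesis
    by (rule that)
qed

text \<open>The injectivity of H(E) -> H(F), stated for cocycles.\<close>

lemma coboundary_in_E:
  assumes e: "e \<in> E k" and eB: "e \<in> coboundaries F d k"
  shows "e \<in> coboundaries (sub_complex F E) d k"
proof -
  let ?c = "cohomology_class (sub_complex F E) d k"
  have one: "\<one>\<^bsub>F k\<^esub> \<in> E k"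
    using subgroup_E by (rule subgroup.one_closed)
  have "cohomology_map F d k id (?c e) = cohomology_map F d k id (?c \<one>\<^bsub>F k\<^esub>)"
    using e eB one by (simp add: cohomology_map_E cohomology_class_eq_iff E_carrier)
  moreover have "inj_on (cohomology_map F d k id) (carrier (cohomology (sub_complex F E) d k))"
    using cohomology_iso by (simp add: iso_def bij_betw_def)
  moreover have "?c e \<in> carrier (cohomology (sub_complex F E) d k)"
    and "?c \<one>\<^bsub>F k\<^esub> \<in> carrier (cohomology (sub_complex F E) d k)"
    using e one coboundaries_closed[OF eB]
    by (auto simp: CE.carrier_cohomology cocycles_sub_complex)
  ultimately have "?c e = ?c \<one>\<^bsub>F k\<^esub>"
    by (simp add: inj_on_eq_iff)
  also have "\<dots> = \<one>\<^bsub>cohomology (sub_complex F E) d k\<^esub>"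
    using surj_homD(3)[OF CE.surj_hom_cohomology_class[of k]] by (simp add: sub_complex_def)
  finally show ?thesis
    using e CE.cohomology_class_eq_one_iff[of e k] by (simp add: sub_complex_def)
qed

text \<open>The spark equation \<open>da = \<phi> - r\<close> for an element a of degree k.\<close>

definition decomposes :: "nat \<Rightarrow> 'a \<Rightarrow> 'a \<Rightarrow> 'a \<Rightarrow> bool"
  where "decomposes k a \<phi> r \<longleftrightarrow> a \<in> carrier (F k) \<and> \<phi> \<in> E (Suc k) \<and> r \<in> I (Suc k) \<and>
    d k a = \<phi> \<otimes>\<^bsub>F (Suc k)\<^esub> inv\<^bsub>F (Suc k)\<^esub> r"

lemma sparks_iff: "a \<in> sparks F d E I k \<longleftrightarrow> (\<exists>\<phi> r. decomposes k a \<phi> r)"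
  by (auto simp: sparks_def decomposes_def)

lemma E_I_eq:
  assumes "x \<in> E (Suc k)" and "y \<in> I (Suc k)" and "x = y"
  shows "x = \<one>\<^bsub>F (Suc k)\<^esub>"
  using assms E_Int_I[of "Suc k"] by auto

lemma decomposition_unique:
  assumes "\<phi> \<in> E (Suc k)" "\<phi>' \<in> E (Suc k)" "r \<in> I (Suc k)" "r' \<in> I (Suc k)"
    and eq: "\<phi> \<otimes>\<^bsub>F (Suc k)\<^esub> inv\<^bsub>F (Suc k)\<^esub> r = \<phi>' \<otimes>\<^bsub>F (Suc k)\<^esub> inv\<^bsub>F (Suc k)\<^esub> r'"
  shows "\<phi> = \<phi>'" and "r = r'"
proof -
  let ?G = "F (Suc k)"
  note cl = assms(1,2)[THEN E_carrier] assms(3,4)[THEN I_carrier]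
  have "inv\<^bsub>?G\<^esub> \<phi>' \<otimes>\<^bsub>?G\<^esub> \<phi> = inv\<^bsub>?G\<^esub> \<phi>' \<otimes>\<^bsub>?G\<^esub> (\<phi> \<otimes>\<^bsub>?G\<^esub> inv\<^bsub>?G\<^esub> r) \<otimes>\<^bsub>?G\<^esub> r"
    using cl by (simp add: grp.m_assoc)
  also have "\<dots> = inv\<^bsub>?G\<^esub> r' \<otimes>\<^bsub>?G\<^esub> r"
    using cl by (simp add: eq flip: grp.m_assoc)
  finally have *: "inv\<^bsub>?G\<^esub> \<phi>' \<otimes>\<^bsub>?G\<^esub> \<phi> = inv\<^bsub>?G\<^esub> r' \<otimes>\<^bsub>?G\<^esub> r" .
  have "inv\<^bsub>?G\<^esub> \<phi>' \<otimes>\<^bsub>?G\<^esub> \<phi> \<in> E (Suc k)" and "inv\<^bsub>?G\<^esub> r' \<otimes>\<^bsub>?G\<^esub> r \<in> I (Suc k)"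
    using assms subgroup_E[of "Suc k"] subgroup_I[of "Suc k"]
    by (simp_all add: subgroup.m_closed subgroup.m_inv_closed)
  with * have "inv\<^bsub>?G\<^esub> \<phi>' \<otimes>\<^bsub>?G\<^esub> \<phi> = \<one>\<^bsub>?G\<^esub>" and "inv\<^bsub>?G\<^esub> r' \<otimes>\<^bsub>?G\<^esub> r = \<one>\<^bsub>?G\<^esub>"
    by (auto dest: E_I_eq)
  then show "\<phi> = \<phi>'" and "r = r'"
    using cl by (metis grp.inv_closed grp.inv_equality grp.inv_inv)+
qed

lemma decomposes_one: "decomposes k \<one>\<^bsub>F k\<^esub> \<one>\<^bsub>F (Suc k)\<^esub> \<one>\<^bsub>F (Suc k)\<^esub>"
  by (simp add: decomposes_def subgroup.one_closed[OF subgroup_E] subgroup.one_closed[OF subgroup_I])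

lemma decomposes_mult:
  assumes "decomposes k a \<phi> r" and "decomposes k b \<psi> s"
  shows "decomposes k (a \<otimes>\<^bsub>F k\<^esub> b) (\<phi> \<otimes>\<^bsub>F (Suc k)\<^esub> \<psi>) (r \<otimes>\<^bsub>F (Suc k)\<^esub> s)"
  using assms E_carrier I_carrier
  by (simp add: decomposes_def subgroup.m_closed[OF subgroup_E] subgroup.m_closed[OF subgroup_I]
      grp.inv_mult grp.m_ac)

lemma decomposes_inv:
  assumes "decomposes k a \<phi> r"
  shows "decomposes k (inv\<^bsub>F k\<^esub> a) (inv\<^bsub>F (Suc k)\<^esub> \<phi>) (inv\<^bsub>F (Suc k)\<^esub> r)"
  using assms E_carrier I_carrier
  by (simp add: decomposes_def subgroup.m_inv_closed[OF subgroup_E]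
      subgroup.m_inv_closed[OF subgroup_I] grp.inv_mult)

lemma decomposes_E: "a \<in> E k \<Longrightarrow> decomposes k a (d k a) \<one>\<^bsub>F (Suc k)\<^esub>"
  by (simp add: decomposes_def E_carrier d_E subgroup.one_closed[OF subgroup_I])

lemma decomposes_I:
  "\<lbrakk>a \<in> carrier (F k); d k a \<in> I (Suc k)\<rbrakk>
    \<Longrightarrow> decomposes k a \<one>\<^bsub>F (Suc k)\<^esub> (inv\<^bsub>F (Suc k)\<^esub> (d k a))"
  by (simp add: decomposes_def subgroup.one_closed[OF subgroup_E] subgroup.m_inv_closed[OF subgroup_I])

lemma decomposes_closed:
  assumes "decomposes k a \<phi> r"
  shows "d (Suc k) \<phi> = \<one>\<^bsub>F (Suc (Suc k))\<^esub>" and "d (Suc k) r = \<one>\<^bsub>F (Suc (Suc k))\<^esub>"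
proof -
  let ?G = "F (Suc (Suc k))"
  have a: "a \<in> carrier (F k)" and \<phi>: "\<phi> \<in> E (Suc k)" and r: "r \<in> I (Suc k)"
    and da: "d k a = \<phi> \<otimes>\<^bsub>F (Suc k)\<^esub> inv\<^bsub>F (Suc k)\<^esub> r"
    using assms by (auto simp: decomposes_def)
  have "d (Suc k) \<phi> \<otimes>\<^bsub>?G\<^esub> inv\<^bsub>?G\<^esub> d (Suc k) r = \<one>\<^bsub>?G\<^esub> \<otimes>\<^bsub>?G\<^esub> inv\<^bsub>?G\<^esub> \<one>\<^bsub>?G\<^esub>"
    using d_d[OF a] E_carrier[OF \<phi>] I_carrier[OF r] by (simp add: da)
  then show "d (Suc k) \<phi> = \<one>\<^bsub>?G\<^esub>" and "d (Suc k) r = \<one>\<^bsub>?G\<^esub>"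
    using decomposition_unique[OF d_E[OF \<phi>] _ d_I[OF r]] subgroup.one_closed[OF subgroup_E]
      subgroup.one_closed[OF subgroup_I] by blast+
qed

lemma subgroup_sparks: "subgroup (sparks F d E I k) (F k)"
proof (rule grp.subgroupI)
  show "sparks F d E I k \<subseteq> carrier (F k)"
    by (auto simp: sparks_def)
  show "sparks F d E I k \<noteq> {}"
    using decomposes_one sparks_iff by blast
  show "inv\<^bsub>F k\<^esub> a \<in> sparks F d E I k" if "a \<in> sparks F d E I k" for a
    using that decomposes_inv sparks_iff by blast
  show "a \<otimes>\<^bsub>F k\<^esub> b \<in> sparks F d E I k" if "a \<in> sparks F d E I k" "b \<in> sparks F d E I k" for a b
    using that by (auto simp: sparks_iff intro: decomposes_mult)
qed

lemma E_subset_sparks: "E k \<subseteq> sparks F d E I k"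
  using decomposes_E sparks_iff by blast

lemma mem_null_sparks_iff:
  "n \<in> null_sparks F d I k \<longleftrightarrow> (\<exists>b\<in>coboundaries F d k. \<exists>s\<in>I k. n = b \<otimes>\<^bsub>F k\<^esub> s)"
  by (auto simp: null_sparks_def set_mult_def)

lemma subgroup_null_sparks: "subgroup (null_sparks F d I k) (F k)"
  unfolding null_sparks_def by (intro grp.mult_subgroups subgroup_coboundaries subgroup_I)

lemma coboundary_null: "b \<in> coboundaries F d k \<Longrightarrow> b \<in> null_sparks F d I k"
  unfolding mem_null_sparks_iff
  using subgroup.one_closed[OF subgroup_I] coboundaries_carrier by (metis grp.r_one)

lemma I_null: "s \<in> I k \<Longrightarrow> s \<in> null_sparks F d I k"
  unfolding mem_null_sparks_iff
  using subgroup.one_closed[OF subgroup_coboundaries] I_carrier by (metis grp.l_one)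

lemma d_null_spark:
  assumes "n \<in> null_sparks F d I k"
  shows "d k n \<in> d k ` I k"
proof -
  obtain b s where b: "b \<in> coboundaries F d k" and s: "s \<in> I k" and n: "n = b \<otimes>\<^bsub>F k\<^esub> s"
    using assms mem_null_sparks_iff by blast
  have "d k n = d k s"
    using coboundaries_carrier[OF b] coboundaries_closed[OF b] I_carrier[OF s] by (simp add: n)
  with s show ?thesis
    by simp
qed

text \<open>The elements of F whose cosets are the cocycles of F/I, that is, those with da in I.\<close>

definition rel_cocycles :: "nat \<Rightarrow> 'a set"
  where "rel_cocycles k = {a \<in> carrier (F k). d k a \<in> I (Suc k)}"

lemma subgroup_rel_cocycles: "subgroup (rel_cocycles k) (F k)"
  using subgroup_I[of "Suc k"] unfolding rel_cocycles_def
  by (intro grp.subgroupI)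
    (auto intro!: exI[of _ "\<one>\<^bsub>F k\<^esub>"] simp: subgroup.m_closed subgroup.m_inv_closed subgroup.one_closed)

lemma rel_cocycles_subset_sparks: "rel_cocycles k \<subseteq> sparks F d E I k"
  using decomposes_I by (fastforce simp: rel_cocycles_def sparks_iff)

lemma cocycles_subset_rel_cocycles: "cocycles F d k \<subseteq> rel_cocycles k"
  by (auto simp: rel_cocycles_def cocycles_iff subgroup.one_closed[OF subgroup_I])

lemma null_subset_rel_cocycles: "null_sparks F d I k \<subseteq> rel_cocycles k"
  using d_null_spark d_I subgroup.mem_carrier[OF subgroup_null_sparks]
  by (fastforce simp: rel_cocycles_def)


section \<open>Presentations of the groups of the diagram\<close>

lemma surj_hom_spark_class:
  "surj_hom (F k\<lparr>carrier := sparks F d E I k\<rparr>) (spark_class F d I k) (spark_group F d E I k)"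
  using grp.surj_hom_quotient[OF subgroup_null_sparks subgroup_sparks]
  by (simp add: spark_group_def spark_class_def[abs_def])

lemma spark_class_eq_iff:
  assumes "a \<in> carrier (F k)" and "b \<in> carrier (F k)"
  shows "spark_class F d I k a = spark_class F d I k b
    \<longleftrightarrow> a \<otimes>\<^bsub>F k\<^esub> inv\<^bsub>F k\<^esub> b \<in> null_sparks F d I k"
  using assms unfolding spark_class_def by (intro grp.coset_eq_iff subgroup_null_sparks)

lemma spark_class_eq_one_iff:
  assumes "a \<in> carrier (F k)"
  shows "spark_class F d I k a = \<one>\<^bsub>spark_group F d E I k\<^esub> \<longleftrightarrow> a \<in> null_sparks F d I k"
  using spark_class_eq_iff[OF assms grp.one_closed] assms surj_homD(3)[OF surj_hom_spark_class]
  by simp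

lemma mem_spark_class_iff:
  "x \<in> spark_class F d I k a \<longleftrightarrow> (\<exists>n\<in>null_sparks F d I k. x = n \<otimes>\<^bsub>F k\<^esub> a)"
  by (auto simp: spark_class_def r_coset_def)

lemma self_mem_spark_class: "a \<in> carrier (F k) \<Longrightarrow> a \<in> spark_class F d I k a"
  unfolding spark_class_def by (rule grp.rcos_self[OF _ subgroup_null_sparks])

lemma carrier_spark_group: "carrier (spark_group F d E I k) = spark_class F d I k ` sparks F d E I k"
  using surj_homD(2)[OF surj_hom_spark_class] by simp

text \<open>A spark class that meets E is the class of any of its elements in E.\<close>

lemma spark_group_E_eq:
  "spark_group_E F d E I k = spark_group F d E I k\<lparr>carrier := spark_class F d I k ` E k\<rparr>"
proof -
  have "spark_class F d I k a \<in> spark_class F d I k ` E k"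
    if a: "a \<in> sparks F d E I k" and e: "e \<in> spark_class F d I k a" "e \<in> E k" for a e
  proof -
    have ac: "a \<in> carrier (F k)"
      using a by (simp add: sparks_def)
    obtain n where n: "n \<in> null_sparks F d I k" and "e = n \<otimes>\<^bsub>F k\<^esub> a"
      using e mem_spark_class_iff by blast
    moreover have "n \<in> carrier (F k)"
      using n by (rule subgroup.mem_carrier[OF subgroup_null_sparks])
    ultimately have "spark_class F d I k e = spark_class F d I k a"
      using ac e n by (simp add: spark_class_eq_iff grp.m_assoc)
    with e show ?thesis
      by (metis imageI)
  qed
  then have "{A \<in> carrier (spark_group F d E I k). A \<inter> E k \<noteq> {}} = spark_class F d I k ` E k"
    using E_subset_sparks E_carrier self_mem_spark_class by (fastforce simp: carrier_spark_group)
  then show ?thesis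
    by (simp add: spark_group_E_def)
qed

lemma surj_hom_spark_class_E:
  "surj_hom (F k\<lparr>carrier := E k\<rparr>) (spark_class F d I k) (spark_group_E F d E I k)"
  using surj_hom_restrict[OF surj_hom_spark_class _ refl, of "E k" k] E_subset_sparks
  by (simp add: spark_group_E_eq)

lemma surj_hom_H_quot_class:
  "surj_hom (F k\<lparr>carrier := rel_cocycles k\<rparr>) (H_quot_class F d I k) (H_quot F d I k)"
proof -
  have "surj_hom (F k) (\<lambda>x. I k #>\<^bsub>F k\<^esub> x) (quot_complex F I k)"
    using grp.surj_hom_quotient[OF subgroup_I grp.subgroup_self] by (simp add: quot_complex_def)
  then have "surj_hom (F k\<lparr>carrier := rel_cocycles k\<rparr>) (\<lambda>x. I k #>\<^bsub>F k\<^esub> x)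
      (quot_complex F I k\<lparr>carrier := cocycles (quot_complex F I) (quot_d F d I) k\<rparr>)"
    using subgroup.subset[OF subgroup_rel_cocycles]
    by (rule surj_hom_restrict) (simp add: rel_cocycles_def cocycles_quot_complex[OF subcomplex_I])
  from surj_hom_comp[OF this CQ.surj_hom_cohomology_class] show ?thesis
    by (simp add: H_quot_def H_quot_class_def[abs_def])
qed

lemma H_quot_class_eq_one_iff:
  assumes a: "a \<in> carrier (F k)"
  shows "H_quot_class F d I k a = \<one>\<^bsub>H_quot F d I k\<^esub> \<longleftrightarrow> a \<in> null_sparks F d I k"
proof -
  have "I k #>\<^bsub>F k\<^esub> a \<in> carrier (quot_complex F I k)"
    using a by (simp add: quot_complex_def carrier_FactGroup)
  then have "H_quot_class F d I k a = \<one>\<^bsub>H_quot F d I k\<^esub>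
      \<longleftrightarrow> (\<exists>b\<in>coboundaries F d k. I k #>\<^bsub>F k\<^esub> a = I k #>\<^bsub>F k\<^esub> b)"
    by (simp add: H_quot_class_def H_quot_def CQ.cohomology_class_eq_one_iff
        coboundaries_quot_complex[OF subcomplex_I] image_iff)
  also have "\<dots> \<longleftrightarrow> a \<in> null_sparks F d I k"
  proof
    assume "\<exists>b\<in>coboundaries F d k. I k #>\<^bsub>F k\<^esub> a = I k #>\<^bsub>F k\<^esub> b"
    then obtain b where b: "b \<in> coboundaries F d k" and "a \<otimes>\<^bsub>F k\<^esub> inv\<^bsub>F k\<^esub> b \<in> I k"
      using a coboundaries_carrier by (auto simp: grp.coset_eq_iff[OF subgroup_I])
    moreover have "a = b \<otimes>\<^bsub>F k\<^esub> (a \<otimes>\<^bsub>F k\<^esub> inv\<^bsub>F k\<^esub> b)"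
      using a coboundaries_carrier[OF b] by (simp add: grp.m_lcomm)
    ultimately show "a \<in> null_sparks F d I k"
      using mem_null_sparks_iff by blast
  next
    assume "a \<in> null_sparks F d I k"
    then obtain b s where b: "b \<in> coboundaries F d k" and s: "s \<in> I k" and "a = b \<otimes>\<^bsub>F k\<^esub> s"
      using mem_null_sparks_iff by blast
    then have "a \<otimes>\<^bsub>F k\<^esub> inv\<^bsub>F k\<^esub> b = s"
      using coboundaries_carrier[OF b] I_carrier[OF s] by (simp add: grp.m_comm[of b] grp.m_assoc)
    with a b s show "\<exists>b\<in>coboundaries F d k. I k #>\<^bsub>F k\<^esub> a = I k #>\<^bsub>F k\<^esub> b"
      using coboundaries_carrier by (auto simp: grp.coset_eq_iff[OF subgroup_I])
  qed
  finally show ?thesis .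
qed

lemma H_quot_class_eq_iff:
  assumes "a \<in> rel_cocycles k" and "b \<in> rel_cocycles k"
  shows "H_quot_class F d I k a = H_quot_class F d I k b
    \<longleftrightarrow> a \<otimes>\<^bsub>F k\<^esub> inv\<^bsub>F k\<^esub> b \<in> null_sparks F d I k"
  using grp.surj_hom_eq_iff[OF subgroup_rel_cocycles surj_hom_H_quot_class assms]
    assms[THEN subgroup.mem_carrier[OF subgroup_rel_cocycles]]
  by (simp add: H_quot_class_eq_one_iff)

lemma carrier_H_I: "carrier (H_I F d I k) = cohomology_class F d k ` cocycles (sub_complex F I) d k"
proof -
  have "cohomology_map F d k id ` carrier (cohomology (sub_complex F I) d k)
      = cohomology_class F d k ` cocycles (sub_complex F I) d k"
    unfolding CI.carrier_cohomology image_image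
    by (intro image_cong refl cohomology_map_I) (simp add: cocycles_sub_complex)
  then show ?thesis
    by (simp add: H_I_def)
qed

lemma subgroup_H_I: "subgroup (carrier (H_I F d I k)) (cohomology F d k)"
  unfolding carrier_H_I
  using surj_hom_cohomology_class subgroup.subgroup_is_group[OF subgroup_cocycles grp.is_group]
    grp.subgroup_incl[OF subgroup_cocycles_sub(2) subgroup_cocycles cocycles_I_subset]
  by (rule surj_hom_subgroup_image)

lemma surj_hom_H_mod_H_I_class:
  "surj_hom (F k\<lparr>carrier := cocycles F d k\<rparr>) (H_mod_H_I_class F d I k) (H_mod_H_I F d I k)"
proof -
  interpret H: comm_group "cohomology F d k"
    by (rule comm_group_cohomology)
  have "surj_hom (cohomology F d k) (\<lambda>c. carrier (H_I F d I k) #>\<^bsub>cohomology F d k\<^esub> c)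
      (H_mod_H_I F d I k)"
    using H.surj_hom_quotient[OF subgroup_H_I H.subgroup_self] by (simp add: H_mod_H_I_def)
  from surj_hom_comp[OF surj_hom_cohomology_class this] show ?thesis
    by (simp add: H_mod_H_I_class_def[abs_def])
qed

lemma mem_H_mod_H_I_class_iff:
  assumes "a \<in> cocycles F d k"
  shows "c \<in> H_mod_H_I_class F d I k a \<longleftrightarrow>
    (\<exists>s\<in>cocycles (sub_complex F I) d k. c = cohomology_class F d k (s \<otimes>\<^bsub>F k\<^esub> a))"
proof -
  have "cohomology_class F d k s \<otimes>\<^bsub>cohomology F d k\<^esub> cohomology_class F d k a
      = cohomology_class F d k (s \<otimes>\<^bsub>F k\<^esub> a)"
    if "s \<in> cocycles (sub_complex F I) d k" for s
    using surj_hom_mult[OF surj_hom_cohomology_class, of s k a] that cocycles_I_subset assms by auto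
  then show ?thesis
    by (auto simp: H_mod_H_I_class_def r_coset_def carrier_H_I)
qed

lemma H_mod_H_I_class_eq_one_iff:
  assumes a: "a \<in> cocycles F d k"
  shows "H_mod_H_I_class F d I k a = \<one>\<^bsub>H_mod_H_I F d I k\<^esub> \<longleftrightarrow> a \<in> null_sparks F d I k"
proof -
  interpret H: comm_group "cohomology F d k"
    by (rule comm_group_cohomology)
  have ac: "a \<in> carrier (F k)"
    using a by (simp add: cocycles_iff)
  have class_a: "cohomology_class F d k a \<in> carrier (cohomology F d k)"
    using a by (simp add: carrier_cohomology)
  have "H_mod_H_I_class F d I k a = \<one>\<^bsub>H_mod_H_I F d I k\<^esub>
      \<longleftrightarrow> cohomology_class F d k a \<in> carrier (H_I F d I k)"
    using H.coset_eq_iff[OF subgroup_H_I class_a H.one_closed] class_a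
      subgroup.subset[OF subgroup_H_I]
    by (simp add: H_mod_H_I_class_def H_mod_H_I_def)
  also have "\<dots> \<longleftrightarrow> (\<exists>s\<in>cocycles (sub_complex F I) d k. a \<otimes>\<^bsub>F k\<^esub> inv\<^bsub>F k\<^esub> s \<in> coboundaries F d k)"
    using ac I_carrier
    by (auto simp: carrier_H_I image_iff cohomology_class_eq_iff cocycles_sub_complex)
  also have "\<dots> \<longleftrightarrow> a \<in> null_sparks F d I k"
  proof
    assume "\<exists>s\<in>cocycles (sub_complex F I) d k. a \<otimes>\<^bsub>F k\<^esub> inv\<^bsub>F k\<^esub> s \<in> coboundaries F d k"
    then obtain s where s: "s \<in> I k" and "a \<otimes>\<^bsub>F k\<^esub> inv\<^bsub>F k\<^esub> s \<in> coboundaries F d k"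
      by (auto simp: cocycles_sub_complex)
    moreover have "a = (a \<otimes>\<^bsub>F k\<^esub> inv\<^bsub>F k\<^esub> s) \<otimes>\<^bsub>F k\<^esub> s"
      using ac I_carrier[OF s] by (simp add: grp.m_assoc)
    ultimately show "a \<in> null_sparks F d I k"
      using mem_null_sparks_iff by blast
  next
    assume "a \<in> null_sparks F d I k"
    then obtain b s where b: "b \<in> coboundaries F d k" and s: "s \<in> I k" and eq: "a = b \<otimes>\<^bsub>F k\<^esub> s"
      using mem_null_sparks_iff by blast
    have "d k s = \<one>\<^bsub>F (Suc k)\<^esub>"
      using a coboundaries_carrier[OF b] coboundaries_closed[OF b] I_carrier[OF s]
      by (simp add: eq cocycles_iff)
    moreover have "a \<otimes>\<^bsub>F k\<^esub> inv\<^bsub>F k\<^esub> s = b"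
      using coboundaries_carrier[OF b] I_carrier[OF s] by (simp add: eq grp.m_assoc)
    ultimately show "\<exists>s\<in>cocycles (sub_complex F I) d k. a \<otimes>\<^bsub>F k\<^esub> inv\<^bsub>F k\<^esub> s \<in> coboundaries F d k"
      using b s by (auto simp: cocycles_sub_complex)
  qed
  finally show ?thesis .
qed

lemma H_mod_H_I_class_eq_iff:
  assumes "a \<in> cocycles F d k" and "b \<in> cocycles F d k"
  shows "H_mod_H_I_class F d I k a = H_mod_H_I_class F d I k b
    \<longleftrightarrow> a \<otimes>\<^bsub>F k\<^esub> inv\<^bsub>F k\<^esub> b \<in> null_sparks F d I k"
  using grp.surj_hom_eq_iff[OF subgroup_cocycles surj_hom_H_mod_H_I_class assms] assms
  by (simp add: H_mod_H_I_class_eq_one_iff subgroup.m_closed subgroup.m_inv_closed subgroup_cocycles)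

text \<open>
  Cocycles of E suffice to represent H(F)/H_I(F); hence the first map of the first row
  is defined everywhere.
\<close>

lemma surj_hom_H_mod_H_I_class_E:
  "surj_hom (F k\<lparr>carrier := cocycles (sub_complex F E) d k\<rparr>)
    (H_mod_H_I_class F d I k) (H_mod_H_I F d I k)"
proof -
  have "H_mod_H_I_class F d I k ` cocycles F d k
      \<subseteq> H_mod_H_I_class F d I k ` cocycles (sub_complex F E) d k"
  proof (rule image_subsetI)
    fix z assume z: "z \<in> cocycles F d k"
    then obtain e where e: "e \<in> cocycles (sub_complex F E) d k"
      and "z \<otimes>\<^bsub>F k\<^esub> inv\<^bsub>F k\<^esub> e \<in> coboundaries F d k"
      by (rule cocycle_cohomologous_E)
    then have "H_mod_H_I_class F d I k z = H_mod_H_I_class F d I k e"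
      using z cocycles_E_subset by (simp add: H_mod_H_I_class_eq_iff coboundary_null subset_iff)
    with e show "H_mod_H_I_class F d I k z
        \<in> H_mod_H_I_class F d I k ` cocycles (sub_complex F E) d k"
      by blast
  qed
  then have "H_mod_H_I_class F d I k ` cocycles (sub_complex F E) d k = carrier (H_mod_H_I F d I k)"
    using surj_homD(2)[OF surj_hom_H_mod_H_I_class, of k]
      image_mono[OF cocycles_E_subset, of "H_mod_H_I_class F d I k" k] by simp
  from surj_hom_restrict[OF surj_hom_H_mod_H_I_class _ this] show ?thesis
    using cocycles_E_subset by simp
qed

lemma H_ker_eq:
  "H_ker F d I k = cohomology (sub_complex F I) d k\<lparr>carrier :=
    cohomology_class (sub_complex F I) d k ` (cocycles (sub_complex F I) d k \<inter> coboundaries F d k)\<rparr>"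
proof -
  have "cohomology_map F d k id (cohomology_class (sub_complex F I) d k r) = \<one>\<^bsub>cohomology F d k\<^esub>
      \<longleftrightarrow> r \<in> coboundaries F d k" if "r \<in> cocycles (sub_complex F I) d k" for r
    using that cohomology_class_eq_one_iff[of r k]
    by (simp add: cocycles_sub_complex cohomology_map_I I_carrier)
  then have "kernel (cohomology (sub_complex F I) d k) (cohomology F d k) (cohomology_map F d k id)
      = cohomology_class (sub_complex F I) d k ` (cocycles (sub_complex F I) d k \<inter> coboundaries F d k)"
    by (auto simp: kernel_def CI.carrier_cohomology)
  then show ?thesis
    by (simp add: H_ker_def)
qed

lemma H_I_eq:
  "H_I F d I k
    = cohomology F d k\<lparr>carrier := cohomology_class F d k ` cocycles (sub_complex F I) d k\<rparr>"
  using carrier_H_I[of k] by (simp add: H_I_def)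

lemma surj_hom_class_H_ker:
  "surj_hom (F k\<lparr>carrier := cocycles (sub_complex F I) d k \<inter> coboundaries F d k\<rparr>)
    (cohomology_class (sub_complex F I) d k) (H_ker F d I k)"
  using surj_hom_restrict[OF surj_hom_class_I _ refl,
      of "cocycles (sub_complex F I) d k \<inter> coboundaries F d k" k]
  by (simp add: H_ker_eq)

lemma surj_hom_class_H_I:
  "surj_hom (F k\<lparr>carrier := cocycles (sub_complex F I) d k\<rparr>) (cohomology_class F d k) (H_I F d I k)"
  using surj_hom_restrict[OF surj_hom_cohomology_class _ refl, of "cocycles (sub_complex F I) d k" k]
    cocycles_I_subset
  by (simp add: H_I_eq)


section \<open>The maps of the diagram on representatives\<close>

lemma H_mod_H_I_to_sparks_class:
  assumes a: "a \<in> cocycles (sub_complex F E) d k"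
  shows "H_mod_H_I_to_sparks F d E I k (H_mod_H_I_class F d I k a) = spark_class F d I k a"
  unfolding H_mod_H_I_to_sparks_def
proof (rule the_elem_image_unique)
  show "{a' \<in> cocycles (sub_complex F E) d k.
      H_mod_H_I_class F d I k a' = H_mod_H_I_class F d I k a} \<noteq> {}"
    using a by blast
  show "spark_class F d I k b = spark_class F d I k a"
    if "b \<in> {a' \<in> cocycles (sub_complex F E) d k.
      H_mod_H_I_class F d I k a' = H_mod_H_I_class F d I k a}" for b
    using that a cocycles_E_subset
    by (auto simp: spark_class_eq_iff H_mod_H_I_class_eq_iff cocycles_sub_complex E_carrier subset_iff)
qed

lemma H_quot_to_sparks_class:
  assumes a: "a \<in> rel_cocycles k"
  shows "H_quot_to_sparks F d I k (H_quot_class F d I k a) = spark_class F d I k a"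
  unfolding H_quot_to_sparks_def
proof (rule the_elem_image_unique)
  let ?R = "{a' \<in> carrier (F k). d k a' \<in> I (Suc k) \<and> H_quot_class F d I k a' = H_quot_class F d I k a}"
  show "?R \<noteq> {}"
    using a by (auto simp: rel_cocycles_def)
  show "spark_class F d I k b = spark_class F d I k a" if "b \<in> ?R" for b
  proof -
    have "b \<in> rel_cocycles k"
      using that by (simp add: rel_cocycles_def)
    then show ?thesis
      using that a H_quot_class_eq_iff[of b k a] by (simp add: spark_class_eq_iff rel_cocycles_def)
  qed
qed

lemma H_mod_H_I_to_H_quot_class:
  assumes a: "a \<in> cocycles F d k"
  shows "H_mod_H_I_to_H_quot F d I k (H_mod_H_I_class F d I k a) = H_quot_class F d I k a"
proof -
  have proj: "cohomology_map (quot_complex F I) (quot_d F d I) k (\<lambda>x. I k #>\<^bsub>F k\<^esub> x)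
      (cohomology_class F d k x) = H_quot_class F d I k x" if "x \<in> carrier (F k)" for x
    unfolding H_quot_class_def
  proof (rule cohomology_map_class[OF cochain_complex_axioms CQ.cochain_complex_axioms _ _ that])
    show "(\<lambda>x. I k #>\<^bsub>F k\<^esub> x) \<in> hom (F k) (quot_complex F I k)"
      using surj_homD(1)[OF grp.surj_hom_quotient[OF subgroup_I grp.subgroup_self]]
      by (simp add: quot_complex_def)
  qed (simp add: coboundaries_quot_complex[OF subcomplex_I])
  have "cohomology_map (quot_complex F I) (quot_d F d I) k (\<lambda>x. I k #>\<^bsub>F k\<^esub> x) c
      = H_quot_class F d I k a" if ca: "c \<in> H_mod_H_I_class F d I k a" for c
  proof -
    obtain s where s: "s \<in> cocycles (sub_complex F I) d k"
      and c: "c = cohomology_class F d k (s \<otimes>\<^bsub>F k\<^esub> a)"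
      using ca a mem_H_mod_H_I_class_iff by blast
    have ac: "a \<in> carrier (F k)" and sI: "s \<in> I k"
      using a s by (simp_all add: cocycles_iff cocycles_sub_complex)
    have "s \<otimes>\<^bsub>F k\<^esub> a \<in> cocycles F d k"
      using a s cocycles_I_subset by (auto intro: subgroup.m_closed[OF subgroup_cocycles])
    then have "H_quot_class F d I k (s \<otimes>\<^bsub>F k\<^esub> a) = H_quot_class F d I k a"
      using a ac I_carrier[OF sI] I_null[OF sI] cocycles_subset_rel_cocycles
      by (auto simp: H_quot_class_eq_iff subset_iff grp.m_assoc)
    then show ?thesis
      using ac I_carrier[OF sI] by (simp add: c proj)
  qed
  then have "cohomology_map (quot_complex F I) (quot_d F d I) k (\<lambda>x. I k #>\<^bsub>F k\<^esub> x)
      ` H_mod_H_I_class F d I k a = (\<lambda>_. H_quot_class F d I k a) ` H_mod_H_I_class F d I k a"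
    by (rule image_cong[OF refl])
  also have "cohomology_class F d k a \<in> H_mod_H_I_class F d I k a"
    unfolding mem_H_mod_H_I_class_iff[OF a]
    using a subgroup.one_closed[OF subgroup_cocycles_sub(2)]
    by (intro bexI[of _ "\<one>\<^bsub>F k\<^esub>"]) (simp_all add: cocycles_iff)
  then have "(\<lambda>_. H_quot_class F d I k a) ` H_mod_H_I_class F d I k a = {H_quot_class F d I k a}"
    by (rule image_constant)
  finally show ?thesis
    by (simp add: H_mod_H_I_to_H_quot_def)
qed

text \<open>
  Independence of the representative: within a spark class \<open>\<phi>\<close> is constant, and r varies only by
  coboundaries of I.
\<close>

lemma decomposes_spark_class:
  assumes a: "decomposes k a \<phi> r" and b: "b \<in> spark_class F d I k a" and "decomposes k b \<phi>' r'"
  shows "\<phi>' = \<phi>" and "r' \<otimes>\<^bsub>F (Suc k)\<^esub> inv\<^bsub>F (Suc k)\<^esub> r \<in> coboundaries (sub_complex F I) d (Suc k)"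
proof -
  obtain n where n: "n \<in> null_sparks F d I k" and bn: "b = n \<otimes>\<^bsub>F k\<^esub> a"
    using b mem_spark_class_iff by blast
  obtain s where s: "s \<in> I k" and ds: "d k n = d k s"
    using d_null_spark[OF n] by blast
  have "decomposes k n \<one>\<^bsub>F (Suc k)\<^esub> (inv\<^bsub>F (Suc k)\<^esub> (d k n))"
    using n null_subset_rel_cocycles by (intro decomposes_I) (auto simp: rel_cocycles_def)
  from decomposes_mult[OF this a]
  have "decomposes k b (\<one>\<^bsub>F (Suc k)\<^esub> \<otimes>\<^bsub>F (Suc k)\<^esub> \<phi>) (inv\<^bsub>F (Suc k)\<^esub> (d k s) \<otimes>\<^bsub>F (Suc k)\<^esub> r)"
    by (simp add: bn ds)
  then have "\<phi>' = \<one>\<^bsub>F (Suc k)\<^esub> \<otimes>\<^bsub>F (Suc k)\<^esub> \<phi>" and r': "r' = inv\<^bsub>F (Suc k)\<^esub> (d k s) \<otimes>\<^bsub>F (Suc k)\<^esub> r"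
    using assms(3) decomposition_unique[of \<phi>' k _ r'] unfolding decomposes_def by auto
  then show "\<phi>' = \<phi>"
    using a by (simp add: decomposes_def E_carrier)
  have "r' \<otimes>\<^bsub>F (Suc k)\<^esub> inv\<^bsub>F (Suc k)\<^esub> r = d k (inv\<^bsub>F k\<^esub> s)"
    using a I_carrier s by (simp add: r' decomposes_def grp.m_assoc)
  then show "r' \<otimes>\<^bsub>F (Suc k)\<^esub> inv\<^bsub>F (Suc k)\<^esub> r \<in> coboundaries (sub_complex F I) d (Suc k)"
    using s by (simp add: coboundaries_sub_complex subgroup.m_inv_closed[OF subgroup_I])
qed

lemma delta1_class:
  assumes a: "decomposes k a \<phi> r"
  shows "delta1 F d E I k (spark_class F d I k a) = \<phi>"
proof -
  have "{\<phi>' \<in> E (Suc k). \<exists>b\<in>spark_class F d I k a. \<exists>r'\<in>I (Suc k).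
      d k b = \<phi>' \<otimes>\<^bsub>F (Suc k)\<^esub> inv\<^bsub>F (Suc k)\<^esub> r'} = {\<phi>}" (is "?S = _")
  proof
    show "{\<phi>} \<subseteq> ?S"
      using a self_mem_spark_class by (auto simp: decomposes_def)
    show "?S \<subseteq> {\<phi>}"
    proof
      fix \<phi>' assume "\<phi>' \<in> ?S"
      then obtain b r' where b: "b \<in> spark_class F d I k a"
        and eq: "\<phi>' \<in> E (Suc k)" "r' \<in> I (Suc k)" "d k b = \<phi>' \<otimes>\<^bsub>F (Suc k)\<^esub> inv\<^bsub>F (Suc k)\<^esub> r'"
        by blast
      have "b \<in> carrier (F k)"
        using b a subgroup.mem_carrier[OF subgroup_null_sparks]
        by (auto simp: mem_spark_class_iff decomposes_def)
      with eq have "decomposes k b \<phi>' r'"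
        by (simp add: decomposes_def)
      then show "\<phi>' \<in> {\<phi>}"
        using decomposes_spark_class(1)[OF a b] by simp
    qed
  qed
  then show ?thesis
    by (simp add: delta1_def)
qed

lemma delta2_class:
  assumes a: "decomposes k a \<phi> r"
  shows "delta2 F d E I k (spark_class F d I k a) = cohomology_class (sub_complex F I) d (Suc k) r"
  unfolding delta2_def
proof (rule the_elem_image_unique)
  let ?R = "{r \<in> I (Suc k). \<exists>b\<in>spark_class F d I k a. \<exists>\<phi>\<in>E (Suc k).
      d k b = \<phi> \<otimes>\<^bsub>F (Suc k)\<^esub> inv\<^bsub>F (Suc k)\<^esub> r}"
  show "?R \<noteq> {}"
    using a self_mem_spark_class by (auto simp: decomposes_def)
  show "cohomology_class (sub_complex F I) d (Suc k) r' = cohomology_class (sub_complex F I) d (Suc k) r"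
    if R: "r' \<in> ?R" for r'
  proof -
    obtain b \<phi>' where b: "b \<in> spark_class F d I k a"
      and eq: "\<phi>' \<in> E (Suc k)" "r' \<in> I (Suc k)" "d k b = \<phi>' \<otimes>\<^bsub>F (Suc k)\<^esub> inv\<^bsub>F (Suc k)\<^esub> r'"
      using R by blast
    have "b \<in> carrier (F k)"
      using b a subgroup.mem_carrier[OF subgroup_null_sparks]
      by (auto simp: mem_spark_class_iff decomposes_def)
    with eq have "decomposes k b \<phi>' r'"
      by (simp add: decomposes_def)
    then show ?thesis
      using decomposes_spark_class(2)[OF a b] eq a
      by (simp add: cohomology_class_I_eq_iff decomposes_def)
  qed
qed

lemma delta2_quot_class:
  assumes a: "a \<in> rel_cocycles k"
  shows "delta2_quot F d I k (H_quot_class F d I k a)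
    = cohomology_class (sub_complex F I) d (Suc k) (inv\<^bsub>F (Suc k)\<^esub> (d k a))"
  unfolding delta2_quot_def
proof (rule the_elem_image_unique)
  let ?R = "{r \<in> I (Suc k). \<exists>b\<in>carrier (F k). d k b = inv\<^bsub>F (Suc k)\<^esub> r \<and>
      H_quot_class F d I k b = H_quot_class F d I k a}"
  have ac: "a \<in> carrier (F k)" and da: "inv\<^bsub>F (Suc k)\<^esub> (d k a) \<in> I (Suc k)"
    using a subgroup.m_inv_closed[OF subgroup_I] by (auto simp: rel_cocycles_def)
  show "?R \<noteq> {}"
    using ac da by (auto intro!: exI[of _ "inv\<^bsub>F (Suc k)\<^esub> (d k a)"])
  show "cohomology_class (sub_complex F I) d (Suc k) r
      = cohomology_class (sub_complex F I) d (Suc k) (inv\<^bsub>F (Suc k)\<^esub> (d k a))" if R: "r \<in> ?R" for r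
  proof -
    obtain b where r: "r \<in> I (Suc k)" and b: "b \<in> carrier (F k)"
      and db: "d k b = inv\<^bsub>F (Suc k)\<^esub> r" and eq: "H_quot_class F d I k b = H_quot_class F d I k a"
      using R by blast
    have "b \<in> rel_cocycles k"
      using b r by (simp add: rel_cocycles_def db subgroup.m_inv_closed[OF subgroup_I])
    with a eq have "b \<otimes>\<^bsub>F k\<^esub> inv\<^bsub>F k\<^esub> a \<in> null_sparks F d I k"
      by (simp add: H_quot_class_eq_iff)
    then have "b \<in> spark_class F d I k a"
      using ac b by (auto simp: mem_spark_class_iff grp.m_assoc intro!: bexI[of _ "b \<otimes>\<^bsub>F k\<^esub> inv\<^bsub>F k\<^esub> a"])
    moreover have "decomposes k b \<one>\<^bsub>F (Suc k)\<^esub> r"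
      using decomposes_I[OF b] r I_carrier[OF r] by (simp add: db subgroup.m_inv_closed[OF subgroup_I])
    moreover have "decomposes k a \<one>\<^bsub>F (Suc k)\<^esub> (inv\<^bsub>F (Suc k)\<^esub> (d k a))"
      using a by (simp add: decomposes_I rel_cocycles_def)
    ultimately show ?thesis
      using decomposes_spark_class(2) r da by (simp add: cohomology_class_I_eq_iff)
  qed
qed

lemma mem_Z_I_iff:
  "\<phi> \<in> carrier (Z_I F d E I (Suc k)) \<longleftrightarrow> (\<exists>a r. decomposes k a \<phi> r)"
proof
  assume "\<phi> \<in> carrier (Z_I F d E I (Suc k))"
  then obtain r a where "\<phi> \<in> E (Suc k)" and "r \<in> I (Suc k)" and "a \<in> carrier (F k)"
    and "d k a = \<phi> \<otimes>\<^bsub>F (Suc k)\<^esub> inv\<^bsub>F (Suc k)\<^esub> r"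
    by (auto simp: Z_I_def cocycles_sub_complex coboundaries_def)
  then show "\<exists>a r. decomposes k a \<phi> r"
    by (auto simp: decomposes_def)
next
  assume "\<exists>a r. decomposes k a \<phi> r"
  then obtain a r where a: "decomposes k a \<phi> r"
    by blast
  have "\<phi> \<otimes>\<^bsub>F (Suc k)\<^esub> inv\<^bsub>F (Suc k)\<^esub> r \<in> coboundaries F d (Suc k)"
    using a by (simp add: decomposes_def coboundaries_def) (metis imageI)
  then show "\<phi> \<in> carrier (Z_I F d E I (Suc k))"
    using a decomposes_closed[OF a] by (auto simp: Z_I_def cocycles_sub_complex decomposes_def)
qed

lemma cohomology_class_decomposition:
  assumes a: "decomposes k a \<phi> r"
  shows "cohomology_class F d (Suc k) \<phi> = cohomology_class F d (Suc k) r"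
proof -
  have "\<phi> \<otimes>\<^bsub>F (Suc k)\<^esub> inv\<^bsub>F (Suc k)\<^esub> r \<in> d k ` carrier (F k)"
    using a unfolding decomposes_def by (metis imageI)
  then show ?thesis
    using a by (simp add: decomposes_def cohomology_class_eq_iff E_carrier I_carrier coboundaries_def)
qed

lemma surj_hom_delta1:
  "surj_hom (F k\<lparr>carrier := sparks F d E I k\<rparr>) (\<lambda>a. delta1 F d E I k (spark_class F d I k a))
    (Z_I F d E I (Suc k))"
proof (rule surj_homI)
  fix a b
  assume "a \<in> carrier (F k\<lparr>carrier := sparks F d E I k\<rparr>)"
    and "b \<in> carrier (F k\<lparr>carrier := sparks F d E I k\<rparr>)"
  then obtain \<phi> r \<psi> s where ab: "decomposes k a \<phi> r" "decomposes k b \<psi> s"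
    by (auto simp: sparks_iff)
  show "delta1 F d E I k (spark_class F d I k (a \<otimes>\<^bsub>F k\<lparr>carrier := sparks F d E I k\<rparr>\<^esub> b))
      = delta1 F d E I k (spark_class F d I k a)
        \<otimes>\<^bsub>Z_I F d E I (Suc k)\<^esub> delta1 F d E I k (spark_class F d I k b)"
    using delta1_class[OF decomposes_mult[OF ab]] ab[THEN delta1_class] by (simp add: Z_I_def)
next
  show "(\<lambda>a. delta1 F d E I k (spark_class F d I k a)) ` carrier (F k\<lparr>carrier := sparks F d E I k\<rparr>)
      = carrier (Z_I F d E I (Suc k))"
  proof
    show "(\<lambda>a. delta1 F d E I k (spark_class F d I k a)) ` carrier (F k\<lparr>carrier := sparks F d E I k\<rparr>)
        \<subseteq> carrier (Z_I F d E I (Suc k))"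
    proof (rule image_subsetI)
      fix a assume "a \<in> carrier (F k\<lparr>carrier := sparks F d E I k\<rparr>)"
      then obtain \<phi> r where a: "decomposes k a \<phi> r"
        by (auto simp: sparks_iff)
      then show "delta1 F d E I k (spark_class F d I k a) \<in> carrier (Z_I F d E I (Suc k))"
        unfolding delta1_class[OF a] mem_Z_I_iff by blast
    qed
    show "carrier (Z_I F d E I (Suc k)) \<subseteq>
        (\<lambda>a. delta1 F d E I k (spark_class F d I k a)) ` carrier (F k\<lparr>carrier := sparks F d E I k\<rparr>)"
    proof
      fix \<phi> assume "\<phi> \<in> carrier (Z_I F d E I (Suc k))"
      then obtain a r where a: "decomposes k a \<phi> r"
        using mem_Z_I_iff by blast
      then have "a \<in> carrier (F k\<lparr>carrier := sparks F d E I k\<rparr>)"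
        by (auto simp: sparks_iff)
      then show "\<phi> \<in>
          (\<lambda>a. delta1 F d E I k (spark_class F d I k a)) ` carrier (F k\<lparr>carrier := sparks F d E I k\<rparr>)"
        using delta1_class[OF a] by (metis imageI)
    qed
  qed
next
  show "delta1 F d E I k (spark_class F d I k \<one>\<^bsub>F k\<lparr>carrier := sparks F d E I k\<rparr>\<^esub>)
      = \<one>\<^bsub>Z_I F d E I (Suc k)\<^esub>"
    using delta1_class[OF decomposes_one] by (simp add: Z_I_def)
qed

lemma surj_hom_delta1_E:
  "surj_hom (F k\<lparr>carrier := E k\<rparr>) (\<lambda>a. delta1 F d E I k (spark_class F d I k a)) (dE F d E k)"
proof -
  have "(\<lambda>a. delta1 F d E I k (spark_class F d I k a)) ` E k = d k ` E k"
    by (intro image_cong refl delta1_class[OF decomposes_E])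
  from surj_hom_restrict[OF surj_hom_delta1 _ this] show ?thesis
    using E_subset_sparks by (simp add: Z_I_def dE_def)
qed

text \<open>
  For surjectivity, a cocycle r of I is cohomologous in F to a cocycle e of E. If \<open>r - e = db\<close>, then
  -b is a spark with decomposition \<open>e - r\<close>.
\<close>

lemma surj_hom_delta2:
  "surj_hom (F k\<lparr>carrier := sparks F d E I k\<rparr>) (\<lambda>a. delta2 F d E I k (spark_class F d I k a))
    (cohomology (sub_complex F I) d (Suc k))"
proof (rule surj_homI)
  fix a b
  assume "a \<in> carrier (F k\<lparr>carrier := sparks F d E I k\<rparr>)"
    and "b \<in> carrier (F k\<lparr>carrier := sparks F d E I k\<rparr>)"
  then obtain \<phi> r \<psi> s where ab: "decomposes k a \<phi> r" "decomposes k b \<psi> s"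
    by (auto simp: sparks_iff)
  have "r \<in> cocycles (sub_complex F I) d (Suc k)" and "s \<in> cocycles (sub_complex F I) d (Suc k)"
    using ab decomposes_closed(2) by (auto simp: cocycles_sub_complex decomposes_def)
  then show "delta2 F d E I k (spark_class F d I k (a \<otimes>\<^bsub>F k\<lparr>carrier := sparks F d E I k\<rparr>\<^esub> b))
      = delta2 F d E I k (spark_class F d I k a)
        \<otimes>\<^bsub>cohomology (sub_complex F I) d (Suc k)\<^esub> delta2 F d E I k (spark_class F d I k b)"
    using delta2_class[OF decomposes_mult[OF ab]] ab[THEN delta2_class]
      surj_hom_mult[OF surj_hom_class_I, of r "Suc k" s] by simp
next
  show "(\<lambda>a. delta2 F d E I k (spark_class F d I k a)) ` carrier (F k\<lparr>carrier := sparks F d E I k\<rparr>)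
      = carrier (cohomology (sub_complex F I) d (Suc k))"
  proof
    show "(\<lambda>a. delta2 F d E I k (spark_class F d I k a)) ` carrier (F k\<lparr>carrier := sparks F d E I k\<rparr>)
        \<subseteq> carrier (cohomology (sub_complex F I) d (Suc k))"
      using decomposes_closed(2)
      by (auto simp: sparks_iff delta2_class CI.carrier_cohomology cocycles_sub_complex decomposes_def
          intro!: imageI)
    show "carrier (cohomology (sub_complex F I) d (Suc k)) \<subseteq>
        (\<lambda>a. delta2 F d E I k (spark_class F d I k a)) ` carrier (F k\<lparr>carrier := sparks F d E I k\<rparr>)"
      unfolding CI.carrier_cohomology
    proof (rule image_subsetI)
      fix r assume r: "r \<in> cocycles (sub_complex F I) d (Suc k)"
      then obtain e where e: "e \<in> cocycles (sub_complex F E) d (Suc k)"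
        and "r \<otimes>\<^bsub>F (Suc k)\<^esub> inv\<^bsub>F (Suc k)\<^esub> e \<in> coboundaries F d (Suc k)"
        using cocycle_cohomologous_E cocycles_I_subset by blast
      then obtain b where b: "b \<in> carrier (F k)"
        and db: "d k b = r \<otimes>\<^bsub>F (Suc k)\<^esub> inv\<^bsub>F (Suc k)\<^esub> e"
        by (auto simp: coboundaries_def)
      have "decomposes k (inv\<^bsub>F k\<^esub> b) e r"
        using r e b by (simp add: decomposes_def cocycles_sub_complex db E_carrier I_carrier
            grp.inv_mult grp.m_comm)
      then show "cohomology_class (sub_complex F I) d (Suc k) r \<in>
          (\<lambda>a. delta2 F d E I k (spark_class F d I k a)) ` carrier (F k\<lparr>carrier := sparks F d E I k\<rparr>)"
        using delta2_class by (force simp: sparks_iff)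
    qed
  qed
next
  show "delta2 F d E I k (spark_class F d I k \<one>\<^bsub>F k\<lparr>carrier := sparks F d E I k\<rparr>\<^esub>)
      = \<one>\<^bsub>cohomology (sub_complex F I) d (Suc k)\<^esub>"
    using delta2_class[OF decomposes_one] surj_homD(3)[OF surj_hom_class_I, of "Suc k"] by simp
qed

lemma delta2_quot_eq_delta2:
  assumes a: "a \<in> rel_cocycles k"
  shows "delta2_quot F d I k (H_quot_class F d I k a) = delta2 F d E I k (spark_class F d I k a)"
  using delta2_quot_class[OF a] delta2_class[OF decomposes_I] a by (simp add: rel_cocycles_def)

text \<open>
  The image is the kernel of H(I) -> H(F), because the elements \<open>-da\<close> of I, with a in F, are
  precisely the cocycles of I that bound in F.
\<close>

lemma surj_hom_delta2_quot:
  "surj_hom (F k\<lparr>carrier := rel_cocycles k\<rparr>) (\<lambda>a. delta2_quot F d I k (H_quot_class F d I k a))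
    (H_ker F d I (Suc k))"
proof (rule surj_hom_cong)
  let ?N = "cocycles (sub_complex F I) d (Suc k) \<inter> coboundaries F d (Suc k)"
  have "(\<lambda>a. inv\<^bsub>F (Suc k)\<^esub> (d k a)) ` rel_cocycles k = ?N"
  proof
    show "(\<lambda>a. inv\<^bsub>F (Suc k)\<^esub> (d k a)) ` rel_cocycles k \<subseteq> ?N"
    proof (rule image_subsetI)
      fix a assume "a \<in> rel_cocycles k"
      then have a: "a \<in> carrier (F k)" and da: "d k a \<in> I (Suc k)"
        by (simp_all add: rel_cocycles_def)
      have "inv\<^bsub>F (Suc k)\<^esub> (d k a) = d k (inv\<^bsub>F k\<^esub> a)"
        using a by simp
      then have "inv\<^bsub>F (Suc k)\<^esub> (d k a) \<in> coboundaries F d (Suc k)"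
        using a by (simp add: coboundaries_def del: d.hom_inv)
      then show "inv\<^bsub>F (Suc k)\<^esub> (d k a) \<in> ?N"
        using da coboundaries_closed subgroup.m_inv_closed[OF subgroup_I]
        by (simp add: cocycles_sub_complex)
    qed
    show "?N \<subseteq> (\<lambda>a. inv\<^bsub>F (Suc k)\<^esub> (d k a)) ` rel_cocycles k"
    proof
      fix r assume "r \<in> ?N"
      then obtain b where b: "b \<in> carrier (F k)" and r: "r = d k b" and "r \<in> I (Suc k)"
        by (auto simp: cocycles_sub_complex coboundaries_def)
      then have "inv\<^bsub>F k\<^esub> b \<in> rel_cocycles k"
        using subgroup.m_inv_closed[OF subgroup_I] by (simp add: rel_cocycles_def)
      moreover have "r = inv\<^bsub>F (Suc k)\<^esub> (d k (inv\<^bsub>F k\<^esub> b))"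
        using b by (simp add: r)
      ultimately show "r \<in> (\<lambda>a. inv\<^bsub>F (Suc k)\<^esub> (d k a)) ` rel_cocycles k"
        by blast
    qed
  qed
  moreover have "(\<lambda>a. delta2 F d E I k (spark_class F d I k a)) ` rel_cocycles k
      = (\<lambda>a. cohomology_class (sub_complex F I) d (Suc k) (inv\<^bsub>F (Suc k)\<^esub> (d k a))) ` rel_cocycles k"
    by (intro image_cong refl delta2_class[OF decomposes_I]) (simp_all add: rel_cocycles_def)
  ultimately have "(\<lambda>a. delta2 F d E I k (spark_class F d I k a)) ` rel_cocycles k
      = cohomology_class (sub_complex F I) d (Suc k) ` ?N"
    by (metis image_image)
  from surj_hom_restrict[OF surj_hom_delta2 _ this]
  show "surj_hom (F k\<lparr>carrier := rel_cocycles k\<rparr>) (\<lambda>a. delta2 F d E I k (spark_class F d I k a))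
      (H_ker F d I (Suc k))"
    using rel_cocycles_subset_sparks by (simp add: H_ker_eq)
  show "group (F k\<lparr>carrier := rel_cocycles k\<rparr>)"
    using subgroup_rel_cocycles grp.is_group by (rule subgroup.subgroup_is_group)
qed (simp add: delta2_quot_eq_delta2)


section \<open>Exactness of the rows and columns\<close>

lemma short_exact_first_row:
  "short_exact (H_mod_H_I F d I k) (H_mod_H_I_to_sparks F d E I k)
    (spark_group_E F d E I k) (delta1 F d E I k) (dE F d E k)"
proof (rule grp.short_exact_presented[OF subgroup_cocycles_sub(1) subgroup_E _
      surj_hom_H_mod_H_I_class_E surj_hom_spark_class_E surj_hom_delta1_E])
  show "cocycles (sub_complex F E) d k \<subseteq> E k"
    by (auto simp: cocycles_sub_complex)
  fix a assume a: "a \<in> cocycles (sub_complex F E) d k"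
  show "H_mod_H_I_to_sparks F d E I k (H_mod_H_I_class F d I k a) = spark_class F d I k a"
    using a by (rule H_mod_H_I_to_sparks_class)
  show "H_mod_H_I_class F d I k a = \<one>\<^bsub>H_mod_H_I F d I k\<^esub>"
    if "spark_class F d I k a = \<one>\<^bsub>spark_group_E F d E I k\<^esub>"
    using that a cocycles_E_subset spark_class_eq_one_iff[of a k]
    by (auto simp: H_mod_H_I_class_eq_one_iff spark_group_E_def cocycles_sub_complex E_carrier subset_iff)
  show "delta1 F d E I k (spark_class F d I k a) = \<one>\<^bsub>dE F d E k\<^esub>"
    using a delta1_class[OF decomposes_E] by (simp add: cocycles_sub_complex dE_def)
next
  fix a assume "a \<in> E k" and "delta1 F d E I k (spark_class F d I k a) = \<one>\<^bsub>dE F d E k\<^esub>"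
  then have "a \<in> cocycles (sub_complex F E) d k"
    using delta1_class[OF decomposes_E] by (simp add: cocycles_sub_complex dE_def)
  then show "\<exists>x\<in>cocycles (sub_complex F E) d k. spark_class F d I k x = spark_class F d I k a"
    by blast
qed

lemma short_exact_second_row:
  "short_exact (H_quot F d I k) (H_quot_to_sparks F d I k)
    (spark_group F d E I k) (delta1 F d E I k) (Z_I F d E I (Suc k))"
proof (rule grp.short_exact_presented[OF subgroup_rel_cocycles subgroup_sparks
      rel_cocycles_subset_sparks surj_hom_H_quot_class surj_hom_spark_class surj_hom_delta1])
  fix a assume a: "a \<in> rel_cocycles k"
  then have ac: "a \<in> carrier (F k)" and da: "d k a \<in> I (Suc k)"
    by (simp_all add: rel_cocycles_def)
  show "H_quot_to_sparks F d I k (H_quot_class F d I k a) = spark_class F d I k a"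
    using a by (rule H_quot_to_sparks_class)
  show "H_quot_class F d I k a = \<one>\<^bsub>H_quot F d I k\<^esub>"
    if "spark_class F d I k a = \<one>\<^bsub>spark_group F d E I k\<^esub>"
    using that ac by (simp add: H_quot_class_eq_one_iff spark_class_eq_one_iff)
  show "delta1 F d E I k (spark_class F d I k a) = \<one>\<^bsub>Z_I F d E I (Suc k)\<^esub>"
    using delta1_class[OF decomposes_I[OF ac da]] by (simp add: Z_I_def)
next
  fix a assume "a \<in> sparks F d E I k"
    and delta: "delta1 F d E I k (spark_class F d I k a) = \<one>\<^bsub>Z_I F d E I (Suc k)\<^esub>"
  then obtain \<phi> r where a: "decomposes k a \<phi> r"
    by (auto simp: sparks_iff)
  then have "\<phi> = \<one>\<^bsub>F (Suc k)\<^esub>"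
    using delta by (simp add: delta1_class Z_I_def)
  with a have "a \<in> rel_cocycles k"
    using subgroup.m_inv_closed[OF subgroup_I] by (simp add: decomposes_def rel_cocycles_def I_carrier)
  then show "\<exists>x\<in>rel_cocycles k. spark_class F d I k x = spark_class F d I k a"
    by blast
qed

lemma short_exact_third_row:
  "short_exact (H_ker F d I k) id
    (cohomology (sub_complex F I) d k) (cohomology_map F d k id) (H_I F d I k)"
proof (rule grp.short_exact_presented[OF _ subgroup_cocycles_sub(2) _ surj_hom_class_H_ker surj_hom_class_I])
  show "subgroup (cocycles (sub_complex F I) d k \<inter> coboundaries F d k) (F k)"
    by (intro grp.subgroups_Inter_pair subgroup_cocycles_sub subgroup_coboundaries)
  show "surj_hom (F k\<lparr>carrier := cocycles (sub_complex F I) d k\<rparr>)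
      (\<lambda>r. cohomology_map F d k id (cohomology_class (sub_complex F I) d k r)) (H_I F d I k)"
    using surj_hom_class_H_I subgroup.subgroup_is_group[OF subgroup_cocycles_sub(2) grp.is_group]
    by (rule surj_hom_cong) (simp add: cohomology_map_I cocycles_sub_complex)
  have one: "cohomology_map F d k id (cohomology_class (sub_complex F I) d k r) = \<one>\<^bsub>H_I F d I k\<^esub>
      \<longleftrightarrow> r \<in> coboundaries F d k" if "r \<in> cocycles (sub_complex F I) d k" for r
    using that cohomology_class_eq_one_iff[of r k]
    by (simp add: cocycles_sub_complex cohomology_map_I I_carrier H_I_def)
  show "cohomology_map F d k id (cohomology_class (sub_complex F I) d k r) = \<one>\<^bsub>H_I F d I k\<^esub>"
    if "r \<in> cocycles (sub_complex F I) d k \<inter> coboundaries F d k" for r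
    using that by (simp add: one)
  show "\<exists>x\<in>cocycles (sub_complex F I) d k \<inter> coboundaries F d k.
      cohomology_class (sub_complex F I) d k x = cohomology_class (sub_complex F I) d k r"
    if "r \<in> cocycles (sub_complex F I) d k"
      and "cohomology_map F d k id (cohomology_class (sub_complex F I) d k r) = \<one>\<^bsub>H_I F d I k\<^esub>" for r
    using that one by blast
qed (auto simp: H_ker_def)

lemma short_exact_left_column:
  "short_exact (H_mod_H_I F d I k) (H_mod_H_I_to_H_quot F d I k)
    (H_quot F d I k) (delta2_quot F d I k) (H_ker F d I (Suc k))"
proof (rule grp.short_exact_presented[OF subgroup_cocycles subgroup_rel_cocycles
      cocycles_subset_rel_cocycles surj_hom_H_mod_H_I_class surj_hom_H_quot_class surj_hom_delta2_quot])
  have one: "delta2_quot F d I k (H_quot_class F d I k a) = \<one>\<^bsub>H_ker F d I (Suc k)\<^esub>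
      \<longleftrightarrow> inv\<^bsub>F (Suc k)\<^esub> (d k a) \<in> d k ` I k" if "a \<in> rel_cocycles k" for a
    using that subgroup.m_inv_closed[OF subgroup_I]
    by (simp add: delta2_quot_class H_ker_def cohomology_class_I_eq_one_iff rel_cocycles_def
        coboundaries_sub_complex)
  fix a assume a: "a \<in> cocycles F d k"
  show "H_mod_H_I_to_H_quot F d I k (H_mod_H_I_class F d I k a) = H_quot_class F d I k a"
    using a by (rule H_mod_H_I_to_H_quot_class)
  show "H_mod_H_I_class F d I k a = \<one>\<^bsub>H_mod_H_I F d I k\<^esub>"
    if "H_quot_class F d I k a = \<one>\<^bsub>H_quot F d I k\<^esub>"
    using that a by (simp add: H_mod_H_I_class_eq_one_iff H_quot_class_eq_one_iff cocycles_iff)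
  have "inv\<^bsub>F (Suc k)\<^esub> (d k a) = d k \<one>\<^bsub>F k\<^esub>"
    using a by (simp add: cocycles_iff)
  then show "delta2_quot F d I k (H_quot_class F d I k a) = \<one>\<^bsub>H_ker F d I (Suc k)\<^esub>"
    using a cocycles_subset_rel_cocycles subgroup.one_closed[OF subgroup_I]
    by (subst one) blast+
next
  fix a assume a: "a \<in> rel_cocycles k"
    and "delta2_quot F d I k (H_quot_class F d I k a) = \<one>\<^bsub>H_ker F d I (Suc k)\<^esub>"
  then obtain s where s: "s \<in> I k" and ds: "inv\<^bsub>F (Suc k)\<^esub> (d k a) = d k s"
    using subgroup.m_inv_closed[OF subgroup_I]
    by (auto simp: delta2_quot_class H_ker_def cohomology_class_I_eq_one_iff rel_cocycles_def
        coboundaries_sub_complex)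
  have ac: "a \<in> carrier (F k)" and sc: "s \<in> carrier (F k)"
    using a s I_carrier by (simp_all add: rel_cocycles_def)
  \<comment> \<open>Adding s turns a into a cocycle and does not change its class in H(F/I).\<close>
  have "d k (s \<otimes>\<^bsub>F k\<^esub> a) = \<one>\<^bsub>F (Suc k)\<^esub>"
    using ac sc by (simp flip: ds)
  then have sa: "s \<otimes>\<^bsub>F k\<^esub> a \<in> cocycles F d k"
    using ac sc by (simp add: cocycles_iff)
  then have "H_quot_class F d I k (s \<otimes>\<^bsub>F k\<^esub> a) = H_quot_class F d I k a"
    using a ac sc I_null[OF s] cocycles_subset_rel_cocycles
    by (simp add: H_quot_class_eq_iff grp.m_assoc subset_iff)
  with sa show "\<exists>x\<in>cocycles F d k. H_quot_class F d I k x = H_quot_class F d I k a"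
    by blast
qed

lemma short_exact_middle_column:
  "short_exact (spark_group_E F d E I k) id
    (spark_group F d E I k) (delta2 F d E I k) (cohomology (sub_complex F I) d (Suc k))"
proof (rule grp.short_exact_presented[OF subgroup_E subgroup_sparks E_subset_sparks
      surj_hom_spark_class_E surj_hom_spark_class surj_hom_delta2])
  fix a assume a: "a \<in> E k"
  show "delta2 F d E I k (spark_class F d I k a) = \<one>\<^bsub>cohomology (sub_complex F I) d (Suc k)\<^esub>"
    using delta2_class[OF decomposes_E[OF a]] surj_homD(3)[OF surj_hom_class_I, of "Suc k"] by simp
next
  fix a assume "a \<in> sparks F d E I k"
    and delta: "delta2 F d E I k (spark_class F d I k a) = \<one>\<^bsub>cohomology (sub_complex F I) d (Suc k)\<^esub>"
  then obtain \<phi> r where a: "decomposes k a \<phi> r"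
    by (auto simp: sparks_iff)
  then have ac: "a \<in> carrier (F k)" and \<phi>: "\<phi> \<in> E (Suc k)" and r: "r \<in> I (Suc k)"
    and da: "d k a = \<phi> \<otimes>\<^bsub>F (Suc k)\<^esub> inv\<^bsub>F (Suc k)\<^esub> r"
    by (auto simp: decomposes_def)
  \<comment> \<open>As [r] = 0, there is s in I with r = ds, so that \<open>\<phi>\<close> = d(a + s).\<close>
  have "r \<in> d k ` I k"
    using delta r by (simp add: delta2_class[OF a] cohomology_class_I_eq_one_iff coboundaries_sub_complex)
  then obtain s where s: "s \<in> I k" and rs: "r = d k s"
    by blast
  note sc = I_carrier[OF s]
  let ?b = "a \<otimes>\<^bsub>F k\<^esub> s"
  have db: "d k ?b = \<phi>"
    using ac sc E_carrier[OF \<phi>] by (simp add: da rs grp.m_assoc)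
  \<comment> \<open>Since H(E) -> H(F) is injective, \<open>\<phi>\<close> is the differential of an element e of E.\<close>
  have "\<phi> \<in> coboundaries F d (Suc k)"
    unfolding db[symmetric] using ac sc by (simp add: coboundaries_def del: d.hom_mult)
  then have "\<phi> \<in> d k ` E k"
    using coboundary_in_E[OF \<phi>] by (simp add: coboundaries_sub_complex)
  then obtain e where e: "e \<in> E k" and \<phi>e: "\<phi> = d k e"
    by blast
  note ec = E_carrier[OF e]
  \<comment> \<open>Since H(E) -> H(F) is surjective, the cocycle a + s - e is cohomologous to an element of E.\<close>
  have "?b \<otimes>\<^bsub>F k\<^esub> inv\<^bsub>F k\<^esub> e \<in> cocycles F d k"
    using ac sc ec db by (simp add: cocycles_iff \<phi>e)
  then obtain e' where e': "e' \<in> cocycles (sub_complex F E) d k"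
    and cob: "?b \<otimes>\<^bsub>F k\<^esub> inv\<^bsub>F k\<^esub> e \<otimes>\<^bsub>F k\<^esub> inv\<^bsub>F k\<^esub> e' \<in> coboundaries F d k"
    by (rule cocycle_cohomologous_E)
  have e'E: "e' \<in> E k"
    using e' by (simp add: cocycles_sub_complex)
  have "a \<otimes>\<^bsub>F k\<^esub> inv\<^bsub>F k\<^esub> (e \<otimes>\<^bsub>F k\<^esub> e')
      = (?b \<otimes>\<^bsub>F k\<^esub> inv\<^bsub>F k\<^esub> e \<otimes>\<^bsub>F k\<^esub> inv\<^bsub>F k\<^esub> e') \<otimes>\<^bsub>F k\<^esub> inv\<^bsub>F k\<^esub> s"
  proof -
    have "?b \<otimes>\<^bsub>F k\<^esub> inv\<^bsub>F k\<^esub> e \<otimes>\<^bsub>F k\<^esub> inv\<^bsub>F k\<^esub> e'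
        = (a \<otimes>\<^bsub>F k\<^esub> inv\<^bsub>F k\<^esub> (e \<otimes>\<^bsub>F k\<^esub> e')) \<otimes>\<^bsub>F k\<^esub> s"
      using ac sc ec E_carrier[OF e'E] by (simp add: grp.inv_mult grp.m_ac)
    then show ?thesis
      using ac sc ec E_carrier[OF e'E] by (simp add: grp.m_assoc)
  qed
  then have "a \<otimes>\<^bsub>F k\<^esub> inv\<^bsub>F k\<^esub> (e \<otimes>\<^bsub>F k\<^esub> e') \<in> null_sparks F d I k"
    using coboundary_null[OF cob] I_null[OF s] subgroup_null_sparks
    by (simp add: subgroup.m_closed subgroup.m_inv_closed)
  then have "spark_class F d I k a = spark_class F d I k (e \<otimes>\<^bsub>F k\<^esub> e')"
    using ac ec E_carrier[OF e'E] by (simp add: spark_class_eq_iff)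
  then show "\<exists>x\<in>E k. spark_class F d I k x = spark_class F d I k a"
    using subgroup.m_closed[OF subgroup_E e e'E] by metis
qed (simp_all add: spark_group_E_def)

lemma short_exact_right_column:
  "short_exact (dE F d E k) id
    (Z_I F d E I (Suc k)) (cohomology_class F d (Suc k)) (H_I F d I (Suc k))"
proof -
  let ?G = "F (Suc k)" and ?Z = "carrier (Z_I F d E I (Suc k))"
  have Z: "Z_I F d E I (Suc k) = ?G\<lparr>carrier := ?Z\<rparr>"
    by (simp add: Z_I_def)
  have E_closed: "\<phi> \<in> E (Suc k)" and cocycle: "\<phi> \<in> cocycles F d (Suc k)" if "\<phi> \<in> ?Z" for \<phi>
    using that decomposes_closed by (auto simp: mem_Z_I_iff cocycles_iff decomposes_def E_carrier)
  have subZ: "subgroup ?Z ?G"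
  proof (rule grp.subgroupI)
    show "?Z \<subseteq> carrier ?G"
      using E_closed E_carrier by blast
    show "?Z \<noteq> {}"
      using decomposes_one mem_Z_I_iff by blast
    show "inv\<^bsub>?G\<^esub> \<phi> \<in> ?Z" if "\<phi> \<in> ?Z" for \<phi>
      using that unfolding mem_Z_I_iff by (blast intro: decomposes_inv)
    show "\<phi> \<otimes>\<^bsub>?G\<^esub> \<psi> \<in> ?Z" if "\<phi> \<in> ?Z" "\<psi> \<in> ?Z" for \<phi> \<psi>
      using that unfolding mem_Z_I_iff by (blast intro: decomposes_mult)
  qed
  show ?thesis
  proof (rule grp.short_exact_presented[of "d k ` E k" "Suc k" ?Z id _ id])
    show "subgroup (d k ` E k) ?G"
      by (rule d.subgroup_img_is_subgroup[OF subgroup_E])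
    show "subgroup ?Z ?G"
      by (rule subZ)
    show "d k ` E k \<subseteq> ?Z"
      using decomposes_E mem_Z_I_iff by blast
    show "surj_hom (?G\<lparr>carrier := d k ` E k\<rparr>) id (dE F d E k)"
      by (rule surj_homI) (simp_all add: dE_def)
    show "surj_hom (?G\<lparr>carrier := ?Z\<rparr>) id (Z_I F d E I (Suc k))"
      by (rule surj_homI) (simp_all flip: Z)
    have "cohomology_class F d (Suc k) ` ?Z
        = cohomology_class F d (Suc k) ` cocycles (sub_complex F I) d (Suc k)"
    proof
      show "cohomology_class F d (Suc k) ` ?Z
          \<subseteq> cohomology_class F d (Suc k) ` cocycles (sub_complex F I) d (Suc k)"
      proof (rule image_subsetI)
        fix \<phi> assume "\<phi> \<in> ?Z"
        then obtain a r where a: "decomposes k a \<phi> r"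
          by (auto simp: mem_Z_I_iff)
        then have "r \<in> cocycles (sub_complex F I) d (Suc k)"
          using decomposes_closed(2)[OF a] by (simp add: cocycles_sub_complex decomposes_def)
        then show "cohomology_class F d (Suc k) \<phi>
            \<in> cohomology_class F d (Suc k) ` cocycles (sub_complex F I) d (Suc k)"
          using cohomology_class_decomposition[OF a] by simp
      qed
      show "cohomology_class F d (Suc k) ` cocycles (sub_complex F I) d (Suc k)
          \<subseteq> cohomology_class F d (Suc k) ` ?Z"
      proof (rule image_subsetI)
        fix r assume r: "r \<in> cocycles (sub_complex F I) d (Suc k)"
        then have rI: "r \<in> I (Suc k)" and rc: "r \<in> cocycles F d (Suc k)"
          using cocycles_I_subset by (auto simp: cocycles_sub_complex)
        from rc obtain e where e: "e \<in> cocycles (sub_complex F E) d (Suc k)"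
          and cob: "r \<otimes>\<^bsub>?G\<^esub> inv\<^bsub>?G\<^esub> e \<in> coboundaries F d (Suc k)"
          by (rule cocycle_cohomologous_E)
        have ec: "e \<in> carrier ?G" and rcar: "r \<in> carrier ?G"
          using e rI by (auto simp: cocycles_sub_complex E_carrier I_carrier)
        have "inv\<^bsub>?G\<^esub> (r \<otimes>\<^bsub>?G\<^esub> inv\<^bsub>?G\<^esub> e) = e \<otimes>\<^bsub>?G\<^esub> inv\<^bsub>?G\<^esub> r"
          using ec rcar by (simp add: grp.inv_mult grp.m_comm)
        then have "e \<otimes>\<^bsub>?G\<^esub> inv\<^bsub>?G\<^esub> r \<in> coboundaries F d (Suc k)"
          using subgroup.m_inv_closed[OF subgroup_coboundaries cob] by simp
        then have "e \<in> ?Z"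
          using e r by (auto simp: Z_I_def)
        moreover have "cohomology_class F d (Suc k) r = cohomology_class F d (Suc k) e"
          using cob ec rcar by (simp add: cohomology_class_eq_iff)
        ultimately show "cohomology_class F d (Suc k) r \<in> cohomology_class F d (Suc k) ` ?Z"
          by blast
      qed
    qed
    from surj_hom_restrict[OF surj_hom_cohomology_class _ this]
    show "surj_hom (?G\<lparr>carrier := ?Z\<rparr>) (\<lambda>\<phi>. cohomology_class F d (Suc k) (id \<phi>)) (H_I F d I (Suc k))"
      using cocycle by (simp add: H_I_eq subset_iff)
    have one: "cohomology_class F d (Suc k) \<phi> = \<one>\<^bsub>H_I F d I (Suc k)\<^esub> \<longleftrightarrow> \<phi> \<in> d k ` E k"
      if "\<phi> \<in> E (Suc k)" for \<phi>
      using that coboundary_in_E[OF that] coboundaries_sub_subset(1)[of "Suc k"]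
        cohomology_class_eq_one_iff[of \<phi> "Suc k"]
      by (auto simp: H_I_def E_carrier coboundaries_sub_complex)
    show "cohomology_class F d (Suc k) (id \<phi>) = \<one>\<^bsub>H_I F d I (Suc k)\<^esub>" if "\<phi> \<in> d k ` E k" for \<phi>
      using that one d_E by auto
    show "\<exists>x\<in>d k ` E k. id x = id \<phi>"
      if "\<phi> \<in> ?Z" and "cohomology_class F d (Suc k) (id \<phi>) = \<one>\<^bsub>H_I F d I (Suc k)\<^esub>" for \<phi>
      using that one E_closed by simp
  qed (simp_all add: dE_def Z_I_def)
qed

end

theorem proposition1p3:
  fixes F :: "nat \<Rightarrow> ('a, 'm) monoid_scheme"
    and d :: "nat \<Rightarrow> 'a \<Rightarrow> 'a"
    and E I :: "nat \<Rightarrow> 'a set"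
    and k :: nat
  assumes "spark_complex F d E I"
    and "k > 0"
  shows
    "short_exact (H_mod_H_I F d I k) (H_mod_H_I_to_sparks F d E I k)
        (spark_group_E F d E I k) (delta1 F d E I k) (dE F d E k) \<and>
     short_exact (H_quot F d I k) (H_quot_to_sparks F d I k)
        (spark_group F d E I k) (delta1 F d E I k) (Z_I F d E I (Suc k)) \<and>
     short_exact (H_ker F d I (Suc k)) id
        (cohomology (sub_complex F I) d (Suc k)) (cohomology_map F d (Suc k) id) (H_I F d I (Suc k)) \<and>
     short_exact (H_mod_H_I F d I k) (H_mod_H_I_to_H_quot F d I k)
        (H_quot F d I k) (delta2_quot F d I k) (H_ker F d I (Suc k)) \<and>
     short_exact (spark_group_E F d E I k) id
        (spark_group F d E I k) (delta2 F d E I k) (cohomology (sub_complex F I) d (Suc k)) \<and>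
     short_exact (dE F d E k) id
        (Z_I F d E I (Suc k)) (cohomology_class F d (Suc k)) (H_I F d I (Suc k)) \<and>
     (\<forall>c\<in>carrier (H_mod_H_I F d I k).
        H_quot_to_sparks F d I k (H_mod_H_I_to_H_quot F d I k c) = id (H_mod_H_I_to_sparks F d E I k c)) \<and>
     (\<forall>A\<in>carrier (spark_group_E F d E I k).
        delta1 F d E I k (id A) = id (delta1 F d E I k A)) \<and>
     (\<forall>c\<in>carrier (H_quot F d I k).
        delta2 F d E I k (H_quot_to_sparks F d I k c) = id (delta2_quot F d I k c)) \<and>
     (\<forall>A\<in>carrier (spark_group F d E I k).
        cohomology_map F d (Suc k) id (delta2 F d E I k A)
          = cohomology_class F d (Suc k) (delta1 F d E I k A))"
proof -
  interpret spark_complex F d E I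
    by fact
  have "H_quot_to_sparks F d I k (H_mod_H_I_to_H_quot F d I k c) = H_mod_H_I_to_sparks F d E I k c"
    if c: "c \<in> carrier (H_mod_H_I F d I k)" for c
  proof -
    obtain a where a: "a \<in> cocycles (sub_complex F E) d k" and ca: "c = H_mod_H_I_class F d I k a"
      using c surj_homD(2)[OF surj_hom_H_mod_H_I_class_E, of k] by auto
    have "a \<in> cocycles F d k"
      using a cocycles_E_subset by blast
    then show ?thesis
      using a cocycles_subset_rel_cocycles
      by (simp add: ca H_mod_H_I_to_H_quot_class H_mod_H_I_to_sparks_class H_quot_to_sparks_class subset_iff)
  qed
  moreover have "delta2 F d E I k (H_quot_to_sparks F d I k c) = delta2_quot F d I k c"
    if c: "c \<in> carrier (H_quot F d I k)" for c
  proof -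
    obtain a where "a \<in> rel_cocycles k" and "c = H_quot_class F d I k a"
      using c surj_homD(2)[OF surj_hom_H_quot_class, of k] by auto
    then show ?thesis
      by (simp add: H_quot_to_sparks_class delta2_quot_eq_delta2)
  qed
  moreover have "cohomology_map F d (Suc k) id (delta2 F d E I k A)
      = cohomology_class F d (Suc k) (delta1 F d E I k A)"
    if A: "A \<in> carrier (spark_group F d E I k)" for A
  proof -
    obtain a \<phi> r where a: "decomposes k a \<phi> r" and Aa: "A = spark_class F d I k a"
      using A by (auto simp: carrier_spark_group sparks_iff)
    then show ?thesis
      using cohomology_class_decomposition[OF a]
      by (simp add: delta1_class[OF a] delta2_class[OF a] cohomology_map_I decomposes_def)
  qed
  ultimately show ?thesis
    by (simp add: short_exact_first_row short_exact_second_row short_exact_third_row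
        short_exact_left_column short_exact_middle_column short_exact_right_column)
qed

end
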